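(* Fix $N\ge 1$. There exists a constant $C>0$ depending only on $N$ such that the following holds. Let $\Lambda\ge 1$, $\beta\in(0,1]$, $\alpha=1-\beta$, $\varepsilon>0$, let $\nu$ be an admissible family, let $\Omega\subset\mathbb{R}^N$ be a bounded domain and let $f:\Omega\to\mathbb{R}$ be a non-negative bounded Borel measurable function. Then for every $x\in\Omega$, $$\mathbb{E}^x\Big[\varepsilon^2\sum_{i=0}^{\tau-1}f(X_i)\Big]\le\big(\varepsilon^2+\alpha\,\mathbb{E}^x[\varepsilon^2\tau]\big)\|f\|_\infty+C(\operatorname{diam}\Omega+\Lambda\varepsilon)\|f\|_N.$$
   Context: $B_r(x)$ is the open ball, $B_r=B_r(0)$; $|E|$ is Lebesgue measure; $\|f\|_\infty=\sup_\Omega|f|$ (a genuine supremum) and $\|f\|_N=\big(\int_\Omega f(x)^N\,dx\big)^{1/N}$. Let $\mathcal{M}(B_\Lambda)$ be the set of Radon probability measures on $\mathbb{R}^N$ with support in $B_\Lambda$ that are symmetric ($\nu(E)=\nu(-E)$ for all measurable $E$). An admissible family is a map $\nu:\mathbb{R}^N\to\mathcal{M}(B_\Lambda)$, $x\mapsto\nu_x$, such that $x\mapsto\int u(x+z)\,d\nu_x(z)$ is Borel measurable for every Borel measurable $u$ (for which these integrals are defined). $\mathbb{P}^{x}$ (with expectation $\mathbb{E}^x$) denotes the law of the Markov chain $(X_k)_{k\ge0}$ in $\mathbb{R}^N$ with $X_0=x$ and transition probabilities $$\mathbb{P}(X_{k+1}\in E\mid X_0,\dots,X_k)=\alpha\,\nu_{X_k}\Big(\frac{E-X_k}{\varepsilon}\Big)+\beta\frac{|E\cap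 B_\varepsilon(X_k)|}{|B_\varepsilon|}$$ for Borel $E$. The exit time is $\tau=\min\{n\ge0:X_n\notin\Omega\}$. *)

theory Defs
  imports "HOL-Probability.Probability"
begin

definition msupport :: "'a::topological_space measure \<Rightarrow> 'a set" where
  "msupport \<mu> = {x. \<forall>U. open U \<and> x \<in> U \<longrightarrow> emeasure \<mu> U > 0}"

text \<open>Every Borel probability measure on \<open>\<real>\<^sup>N\<close> is Radon, so no separate regularity clause is needed.\<close>

definition sym_prob_measures :: "real \<Rightarrow> (real ^ 'n) measure set" where
  "sym_prob_measures \<Lambda> =
    {\<mu>. prob_space \<mu> \<and> sets \<mu> = sets borel \<and> msupport \<mu> \<subseteq> ball 0 \<Lambda> \<and>
        (\<forall>E \<in> sets borel. emeasure \<mu> E = emeasure \<mu> (uminus ` E))}"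

definition admissible_family :: "real \<Rightarrow> (real ^ 'n \<Rightarrow> (real ^ 'n) measure) \<Rightarrow> bool" where
  "admissible_family \<Lambda> \<nu> \<longleftrightarrow>
    (\<forall>x. \<nu> x \<in> sym_prob_measures \<Lambda>) \<and>
    (\<forall>u :: real ^ 'n \<Rightarrow> real. u \<in> borel_measurable borel \<longrightarrow>
       (\<forall>x. integrable (\<nu> x) (\<lambda>z. u (x + z))) \<longrightarrow>
       (\<lambda>x. \<integral>z. u (x + z) \<partial>\<nu> x) \<in> borel_measurable borel)"

definition transition_prob ::
  "real \<Rightarrow> real \<Rightarrow> real \<Rightarrow> (real ^ 'n \<Rightarrow> (real ^ 'n) measure) \<Rightarrow> real ^ 'n \<Rightarrow> (real ^ 'n) set \<Rightarrow> real" where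
  "transition_prob \<alpha> \<beta> \<epsilon> \<nu> x E =
     \<alpha> * measure (\<nu> x) ((\<lambda>y. (y - x) /\<^sub>R \<epsilon>) ` E)
     + \<beta> * (measure lborel (E \<inter> ball x \<epsilon>) / measure lborel (ball (0 :: real ^ 'n) \<epsilon>))"

text \<open>The chain lives on the path space \<open>nat \<Rightarrow> \<real>\<^sup>N\<close> with the product sigma-algebra, \<open>X\<^sub>k\<close> being
  the coordinate map \<open>\<lambda>\<omega>. \<omega> k\<close>. The following is the sigma-algebra generated by \<open>X\<^sub>0, \<dots>, X\<^sub>k\<close>.\<close>

definition past_algebra :: "nat \<Rightarrow> (nat \<Rightarrow> real ^ 'n) measure" where
  "past_algebra k = sigma UNIV {(\<lambda>\<omega>. \<omega> i) -` A | i A. i \<le> k \<and> A \<in> sets borel}"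

definition chain_law ::
  "real \<Rightarrow> real \<Rightarrow> real \<Rightarrow> (real ^ 'n \<Rightarrow> (real ^ 'n) measure) \<Rightarrow> real ^ 'n \<Rightarrow>
   (nat \<Rightarrow> real ^ 'n) measure \<Rightarrow> bool" where
  "chain_law \<alpha> \<beta> \<epsilon> \<nu> x P \<longleftrightarrow>
     prob_space P \<and> sets P = sets (\<Pi>\<^sub>M k\<in>UNIV. borel) \<and>
     (AE \<omega> in P. \<omega> 0 = x) \<and>
     (\<forall>k. \<forall>E \<in> sets borel. AE \<omega> in P.
        real_cond_exp P (past_algebra k) (indicator {\<omega>. \<omega> (Suc k) \<in> E}) \<omega>
          = transition_prob \<alpha> \<beta> \<epsilon> \<nu> (\<omega> k) E)"

text \<open>Value \<open>\<infinity>\<close> if the path never leaves \<open>\<Omega>\<close>, since \<open>Inf {} = \<infinity>\<close> in \<^typ>\<open>enat\<close>.\<close>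

definition exit_time :: "'a set \<Rightarrow> (nat \<Rightarrow> 'a) \<Rightarrow> enat" where
  "exit_time \<Omega> \<omega> = Inf (enat ` {n. \<omega> n \<notin> \<Omega>})"

definition sup_norm_on :: "'a set \<Rightarrow> ('a \<Rightarrow> real) \<Rightarrow> real" where
  "sup_norm_on \<Omega> f = (SUP x\<in>\<Omega>. \<bar>f x\<bar>)"

definition LN_norm_on :: "(real ^ 'n) set \<Rightarrow> (real ^ 'n \<Rightarrow> real) \<Rightarrow> real" where
  "LN_norm_on \<Omega> f = (LINT x:\<Omega>|lborel. f x ^ CARD('n)) powr (1 / real CARD('n))"

end

theory Submission
  imports Defs
begin

text \<open>
  Conditioning on the previous step replaces \<open>f (X\<^sub>i\<^sub>+\<^sub>1)\<close> by its one-step average, which is at most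
  \<open>\<alpha> \<parallel>f\<parallel>\<^sub>\<infinity>\<close> plus \<open>\<beta>\<close> times the average \<open>g\<close> of \<open>f\<close> over \<open>B\<^sub>\<epsilon> (X\<^sub>i)\<close>. It remains to bound
  \<open>\<epsilon>\<^sup>2 \<beta> E \<Sum> g (X\<^sub>i)\<close>, a limit of functions \<open>w\<close> vanishing outside \<open>\<Omega>\<close> and satisfying
  \<open>w x \<le> \<alpha> \<integral> w (x + \<epsilon> z) d\<nu>\<^sub>x + \<beta> w\<^sub>\<epsilon> x + \<epsilon>\<^sup>2 \<beta> g x\<close> (with \<open>w\<^sub>\<epsilon> x\<close> the average of \<open>w\<close> over \<open>B\<^sub>\<epsilon> (x)\<close>) in \<open>\<Omega>\<close>.

  Every slope \<open>p\<close> with \<open>\<bar>p\<bar> (diam \<Omega> + \<Lambda> \<epsilon>) < w x\<^sub>0\<close> is attained by an affine function lying above \<open>w\<close>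
  on the \<open>\<Lambda> \<epsilon>\<close>-neighbourhood of \<open>\<Omega>\<close> and almost touching it at a point of \<open>\<Omega>\<close>. There the
  symmetry of \<open>\<nu>\<^sub>x\<close> removes the \<open>\<alpha>\<close>-term and \<open>\<beta>\<close> cancels, so the affine function exceeds \<open>w\<close> on average
  by at most \<open>\<epsilon>\<^sup>2 g x\<close> over \<open>B\<^sub>\<epsilon> (x)\<close>. Two such slopes with contact points in one grid cell of diameter
  about \<open>\<epsilon>\<close> then differ by at most a multiple of \<open>\<epsilon>\<close> times the local average of \<open>f\<close>. The slope ball is
  thus covered by one small ball per cell; comparing volumes and applying Jensen's
  inequality in each cell yields the bound by \<open>\<parallel>f\<parallel>\<^sub>N\<close>.
\<close>

section \<open>Symmetric measures and affine functions on balls\<close>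

text \<open>The complement of the support is a union of open null sets. By the Lindelof property
  countably many of them already cover it, so it is null.\<close>

lemma AE_in_msupport:
  fixes \<mu> :: "'a::second_countable_topology measure"
  assumes [measurable_cong]: "sets \<mu> = sets borel"
  shows "AE x in \<mu>. x \<in> msupport \<mu>"
proof -
  define \<U> where "\<U> = {U. open U \<and> emeasure \<mu> U = 0}"
  have "\<And>U. U \<in> \<U> \<Longrightarrow> openin (top_of_set UNIV) U"
    by (auto simp: \<U>_def)
  then obtain \<V> where \<V>: "\<V> \<subseteq> \<U>" "countable \<V>" "\<Union>\<V> = \<Union>\<U>"
    by (rule Lindelof_openin)
  have "U \<in> null_sets \<mu>" if "U \<in> \<V>" for U
    using that \<V>(1) assms by (auto simp: \<U>_def null_sets_def)
  then have "(\<Union>U\<in>\<V>. U) \<in> null_sets \<mu>"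
    by (intro null_sets_UN' \<V>(2))
  moreover have "{x \<in> space \<mu>. x \<notin> msupport \<mu>} \<subseteq> (\<Union>U\<in>\<V>. U)"
    using \<V>(3) by (auto simp: msupport_def \<U>_def not_less)
  ultimately show ?thesis
    by (rule AE_I'[rotated -1, rotated])
qed

lemma AE_sym_prob_measures:
  assumes "\<mu> \<in> sym_prob_measures \<Lambda>"
  shows "AE z in \<mu>. norm z < \<Lambda>"
proof -
  have "sets \<mu> = sets borel" "msupport \<mu> \<subseteq> ball 0 \<Lambda>"
    using assms by (auto simp: sym_prob_measures_def)
  then show ?thesis
    using AE_in_msupport[of \<mu>] by (auto elim!: eventually_mono)
qed

lemma distr_uminus_sym_prob_measures:
  assumes "\<mu> \<in> sym_prob_measures \<Lambda>"
  shows "distr \<mu> borel uminus = \<mu>"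
proof (rule measure_eqI)
  have [measurable_cong]: "sets \<mu> = sets borel"
    using assms by (auto simp: sym_prob_measures_def)
  show "sets (distr \<mu> borel uminus) = sets \<mu>"
    by (simp add: \<open>sets \<mu> = sets borel\<close>)
  fix A assume A: "A \<in> sets (distr \<mu> borel uminus)"
  have "uminus -` A \<inter> space \<mu> = uminus ` A"
    using sets_eq_imp_space_eq[OF \<open>sets \<mu> = sets borel\<close>] by force
  then show "emeasure (distr \<mu> borel uminus) A = emeasure \<mu> A"
    using A assms by (subst emeasure_distr) (auto simp: sym_prob_measures_def)
qed

text \<open>Reflection turns the integral into its negative. Integrability comes from the bounded
  support; it is what later allows the integral of an affine function to be split.\<close>

lemma sym_prob_measures_inner:
  fixes p :: "real ^ 'n"
  assumes \<mu>: "\<mu> \<in> sym_prob_measures \<Lambda>"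
  shows "integrable \<mu> (\<lambda>z. p \<bullet> z)" "(\<integral>z. p \<bullet> z \<partial>\<mu>) = 0"
proof -
  have [measurable_cong]: "sets \<mu> = sets borel"
    using assms by (auto simp: sym_prob_measures_def)
  interpret prob_space \<mu>
    using assms by (auto simp: sym_prob_measures_def)
  show "integrable \<mu> (\<lambda>z. p \<bullet> z)"
  proof (rule integrable_const_bound[where B = "norm p * \<Lambda>"])
    show "AE z in \<mu>. norm (p \<bullet> z) \<le> norm p * \<Lambda>"
      using AE_sym_prob_measures[OF \<mu>]
    proof eventually_elim
      case (elim z)
      have "norm (p \<bullet> z) \<le> norm p * norm z"
        by (simp add: Cauchy_Schwarz_ineq2)
      also have "\<dots> \<le> norm p * \<Lambda>"
        using elim by (intro mult_left_mono) auto
      finally show ?case .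
    qed
  qed measurable
  have "(\<integral>z. p \<bullet> z \<partial>\<mu>) = (\<integral>z. p \<bullet> z \<partial>distr \<mu> borel uminus)"
    by (simp add: distr_uminus_sym_prob_measures[OF \<mu>])
  also have "\<dots> = - (\<integral>z. p \<bullet> z \<partial>\<mu>)"
    by (subst integral_distr) auto
  finally show "(\<integral>z. p \<bullet> z \<partial>\<mu>) = 0"
    by simp
qed

text \<open>The reflection through \<open>x\<close> preserves Lebesgue measure and the ball, but
  flips the sign of the integrand.\<close>

lemma integral_inner_ball_eq_0:
  fixes p :: "'a::euclidean_space"
  shows "(\<integral>y. indicator (ball x r) y * (p \<bullet> (y - x)) \<partial>lborel) = 0" (is "?I = 0")
proof -
  have "?I = (\<integral>y. indicator (ball x r) y * (p \<bullet> (y - x))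
      \<partial>density (distr lborel borel (\<lambda>y. 2 *\<^sub>R x + (-1) *\<^sub>R y)) (\<lambda>_. \<bar>-1::real\<bar> ^ DIM('a)))"
    by (rule arg_cong[where f = "\<lambda>M. integral\<^sup>L M _"], rule lborel_affine) simp
  also have "\<dots> = (\<integral>y. indicator (ball x r) (2 *\<^sub>R x - y) * (p \<bullet> (2 *\<^sub>R x - y - x)) \<partial>lborel)"
    by (simp add: density_1) (subst integral_distr, auto intro!: borel_measurable_times borel_measurable_indicator)
  also have "\<dots> = (\<integral>y. - (indicator (ball x r) y * (p \<bullet> (y - x))) \<partial>lborel)"
  proof (intro Bochner_Integration.integral_cong refl)
    fix y
    have "dist x (2 *\<^sub>R x - y) = dist x y"
      by (simp add: dist_norm scaleR_2 norm_minus_commute)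
    then show "indicator (ball x r) (2 *\<^sub>R x - y) * (p \<bullet> (2 *\<^sub>R x - y - x)) =
        - (indicator (ball x r) y * (p \<bullet> (y - x)))"
      by (auto simp: indicator_def inner_diff_right inner_add_right scaleR_2)
  qed
  finally show ?thesis
    by simp
qed

text \<open>The offset \<open>b\<close> cannot cancel the slope everywhere: on the side of the ball
  where the linear part has the sign of \<open>b\<close>, the two add up. The bound is free of
  \<open>b\<close>, which is not controlled when the affine function is a difference of two contact
  planes.\<close>

lemma slope_le_integral:
  fixes q :: "'a::euclidean_space"
  assumes r: "r > 0" and F: "integrable lborel F" "\<And>y. 0 \<le> F y"
    and bound: "\<And>y. y \<in> ball c r \<Longrightarrow> \<bar>b + q \<bullet> (y - c)\<bar> \<le> F y"
  shows "norm q * r / 4 * measure lborel (ball (0::'a) (r / 4)) \<le> (\<integral>y. F y \<partial>lborel)"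
proof (cases "q = 0")
  case True
  then show ?thesis using F by simp
next
  case False
  define e where "e = (if b \<ge> 0 then 1 else -1) *\<^sub>R (q /\<^sub>R norm q)"
  \<comment> \<open>Distance \<open>r / 2\<close> and radius \<open>r / 4\<close> keep
    \<open>B\<close> inside \<open>ball c r\<close> and leave a linear part of size at least
    \<open>norm q * (r / 2 - r / 4)\<close> on it.\<close>
  define B where "B = ball (c + (r / 2) *\<^sub>R e) (r / 4)"
  have e: "norm e = 1"
    using False by (simp add: e_def)
  have qe: "q \<bullet> e = (if b \<ge> 0 then norm q else - norm q)"
    using False by (simp add: e_def power2_norm_eq_inner[symmetric] power2_eq_square)
  \<comment> \<open>On \<open>B\<close> the affine function has the sign of \<open>b\<close> and is at least the linear part in size.\<close>
  have "norm q * r / 4 \<le> F y" if "y \<in> B" for y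
  proof -
    define v where "v = y - (c + (r / 2) *\<^sub>R e)"
    have v: "norm v < r / 4"
      using that by (simp add: B_def v_def dist_norm norm_minus_commute)
    have y: "y - c = (r / 2) *\<^sub>R e + v"
      by (simp add: v_def)
    have "norm (y - c) \<le> norm ((r / 2) *\<^sub>R e) + norm v"
      unfolding y by (rule norm_triangle_ineq)
    then have "y \<in> ball c r"
      using v e r by (simp add: dist_norm norm_minus_commute)
    then have le: "\<bar>b + q \<bullet> (y - c)\<bar> \<le> F y"
      by (rule bound)
    have "\<bar>q \<bullet> v\<bar> \<le> norm q * norm v"
      by (rule Cauchy_Schwarz_ineq2)
    also have "\<dots> \<le> norm q * (r / 4)"
      using v by (intro mult_left_mono) auto
    finally have "\<bar>q \<bullet> v\<bar> \<le> norm q * r / 4"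
      by simp
    moreover have "q \<bullet> (y - c) = (r / 2) * (q \<bullet> e) + q \<bullet> v"
      by (simp add: y inner_add_right)
    ultimately show ?thesis
      using le unfolding qe by (auto simp: mult.commute[of r] abs_real_def split: if_splits)
  qed
  moreover have "integrable lborel (\<lambda>y. indicator B y * (norm q * r / 4))"
    by (intro integrable_mult_left integrable_real_indicator)
      (use emeasure_lborel_ball_finite in \<open>auto simp: B_def\<close>)
  ultimately have "(\<integral>y. indicator B y * (norm q * r / 4) \<partial>lborel) \<le> (\<integral>y. F y \<partial>lborel)"
    using F by (intro integral_mono) (auto simp: indicator_def)
  moreover have "(\<integral>y. indicator B y * (norm q * r / 4) \<partial>lborel) =
      norm q * r / 4 * measure lborel (ball (0::'a) (r / 4))"
    using r by (simp add: B_def content_ball)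
  ultimately show ?thesis
    by (simp only:)
qed

section \<open>Jensen's inequality for powers\<close>

lemma power_ge_tangent:
  fixes a t :: real
  assumes "a \<ge> 0" "t > 0"
  shows "t ^ n + real n * t ^ n * (a / t - 1) \<le> a ^ n"
proof -
  have "1 + real n * (a / t - 1) \<le> (1 + (a / t - 1)) ^ n"
    using assms by (intro Bernoulli_inequality) auto
  then have "t ^ n * (1 + real n * (a / t - 1)) \<le> t ^ n * (a / t) ^ n"
    using assms by (intro mult_left_mono) auto
  then show ?thesis
    using assms by (simp add: algebra_simps power_divide)
qed

text \<open>The graph of the power lies above its tangent at the mean value \<open>t\<close> of
  \<open>f\<close> over \<open>S\<close>; integrating over \<open>S\<close> kills the linear term of
  the tangent. Multiplying by \<open>m ^ (n - 1)\<close> then replaces the mean by the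
  integral.\<close>

lemma integral_power_le:
  fixes f :: "'a \<Rightarrow> real"
  assumes "n \<ge> 1" and nonneg: "\<And>x. 0 \<le> f x"
    and int: "integrable M (\<lambda>x. indicator S x * f x)" "integrable M (\<lambda>x. indicator S x * f x ^ n)"
    and S: "S \<in> sets M" "emeasure M S < \<infinity>" "measure M S > 0"
  shows "(\<integral>x. indicator S x * f x \<partial>M) ^ n \<le>
    measure M S ^ (n - 1) * (\<integral>x. indicator S x * f x ^ n \<partial>M)"
proof -
  define m t where "m = measure M S" and "t = (\<integral>x. indicator S x * f x \<partial>M) / m"
  have I: "(\<integral>x. indicator S x * f x \<partial>M) = m * t"
    using S by (simp add: t_def m_def)
  have "t \<ge> 0"
    using nonneg by (auto simp: t_def m_def intro!: divide_nonneg_nonneg integral_nonneg)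
  have "m * t ^ n \<le> (\<integral>x. indicator S x * f x ^ n \<partial>M)"
  \<comment> \<open>The tangent is written with the slope \<open>c / t\<close>, so a vanishing mean
    is treated apart.\<close>
  proof (cases "t = 0")
    case True
    then show ?thesis using nonneg \<open>n \<ge> 1\<close> by (simp add: power_0_left integral_nonneg)
  next
    case False
    with \<open>t \<ge> 0\<close> have "t > 0" by simp
    define c where "c = real n * t ^ n"
    have iS: "integrable M (indicator S :: _ \<Rightarrow> real)"
      using S by (intro integrable_real_indicator) auto
    have "(\<integral>x. (t ^ n - c) * indicator S x + c / t * (indicator S x * f x) \<partial>M) \<le>
        (\<integral>x. indicator S x * f x ^ n \<partial>M)"
    proof (intro integral_mono)
      show "integrable M (\<lambda>x. (t ^ n - c) * indicator S x + c / t * (indicator S x * f x))"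
        using iS int by (intro Bochner_Integration.integrable_add integrable_mult_right) auto
      show "(t ^ n - c) * indicator S x + c / t * (indicator S x * f x) \<le> indicator S x * f x ^ n" for x
        using power_ge_tangent[OF nonneg[of x] \<open>t > 0\<close>, of n]
        by (auto simp: indicator_def c_def algebra_simps)
    qed (use int in auto)
    also have "(\<integral>x. (t ^ n - c) * indicator S x + c / t * (indicator S x * f x) \<partial>M) =
        (t ^ n - c) * m + c / t * (m * t)"
      using iS int S by (simp add: I m_def)
    also have "\<dots> = m * t ^ n"
      using \<open>t > 0\<close> by (simp add: algebra_simps)
    finally show ?thesis .
  qed
  then have "m ^ (n - 1) * (m * t ^ n) \<le> m ^ (n - 1) * (\<integral>x. indicator S x * f x ^ n \<partial>M)"
    using S by (intro mult_left_mono) (auto simp: m_def)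
  moreover have "m ^ (n - 1) * (m * t ^ n) = (m * t) ^ n"
    using \<open>n \<ge> 1\<close> by (cases n) (auto simp: power_mult_distrib)
  ultimately show ?thesis
    by (simp add: I flip: m_def)
qed

section \<open>Near-contact points\<close>

text \<open>A plane of slope \<open>p\<close> is lowered until it almost touches \<open>w\<close>
  over the \<open>\<rho>\<close>-neighbourhood \<open>D\<close> of \<open>\<Omega>\<close>; the
  contact point is a near-maximiser of \<open>w y - p \<bullet> y\<close>. The supremum need not be
  attained, as \<open>w\<close> is only bounded, hence the slack \<open>\<delta>\<close>.\<close>

lemma near_contact_point:
  fixes w :: "'a::euclidean_space \<Rightarrow> real"
  assumes "bounded \<Omega>" "x0 \<in> \<Omega>" "\<rho> > 0" "\<delta> > 0"
    and w: "\<And>y. w y \<le> W" "\<And>y. y \<notin> \<Omega> \<Longrightarrow> w y = 0"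
    and p: "norm p * (diameter \<Omega> + \<rho>) < w x0"
  obtains x where "x \<in> \<Omega>"
    "\<And>x' y. x' \<in> \<Omega> \<Longrightarrow> y \<in> ball x' \<rho> \<Longrightarrow> w y \<le> w x + p \<bullet> (y - x) + \<delta>"
proof -
  define R where "R = diameter \<Omega> + \<rho>"
  define D where "D = (\<Union>x\<in>\<Omega>. ball x \<rho>)"
  define g where "g y = w y - p \<bullet> y" for y
  \<comment> \<open>With a tolerance of at most half the gap \<open>w x0 - norm p * R\<close>, a
    near-maximiser cannot lie outside \<open>\<Omega>\<close>: there \<open>w\<close> vanishes, and
    \<open>w y - p \<bullet> y\<close> stays below its value at \<open>x0\<close> by at least the
    whole gap.\<close>
  define \<delta>' where "\<delta>' = min \<delta> ((w x0 - norm p * R) / 2)"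
  have "\<delta>' > 0"
    using \<open>\<delta> > 0\<close> p by (simp add: \<delta>'_def R_def)
  have "x0 \<in> D"
    using assms by (auto simp: D_def intro!: bexI[of _ x0])
  have inner: "- (p \<bullet> (y - x0)) \<le> norm p * R" if y: "y \<in> D" for y
  proof -
    obtain x where x: "x \<in> \<Omega>" "dist x y < \<rho>"
      using y by (auto simp: D_def)
    have "norm (y - x0) \<le> dist x0 x + dist x y"
      by (metis dist_triangle dist_norm norm_minus_commute)
    also have "\<dots> \<le> R"
      using diameter_bounded_bound[OF \<open>bounded \<Omega>\<close> \<open>x0 \<in> \<Omega>\<close> x(1)] x(2) by (simp add: R_def)
    finally have "norm p * norm (y - x0) \<le> norm p * R"
      by (intro mult_left_mono) auto
    then show ?thesis
      using Cauchy_Schwarz_ineq2[of p "y - x0"] by linarith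
  qed
  have bdd: "bdd_above (g ` D)"
  proof (rule bdd_aboveI2)
    show "g y \<le> W + norm p * R - p \<bullet> x0" if "y \<in> D" for y
      using inner[OF that] w(1)[of y] by (simp add: g_def inner_diff_right)
  qed
  have "\<exists>x\<in>D. (SUP y\<in>D. g y) - \<delta>' < g x"
    using \<open>x0 \<in> D\<close> \<open>\<delta>' > 0\<close> bdd by (subst less_cSUP_iff[symmetric]) auto
  then obtain x where x: "x \<in> D" "(SUP y\<in>D. g y) - \<delta>' < g x"
    by blast
  have le: "g y < g x + \<delta>'" if "y \<in> D" for y
    using cSUP_upper[OF that bdd] x(2) by simp
  have "x \<in> \<Omega>"
  proof (rule ccontr)
    assume "x \<notin> \<Omega>"
    then have "g x = - (p \<bullet> (x - x0)) - p \<bullet> x0"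
      by (simp add: g_def w(2) inner_diff_right)
    then have "g x \<le> norm p * R - p \<bullet> x0"
      using inner[OF x(1)] by simp
    moreover have "2 * \<delta>' \<le> w x0 - norm p * R"
      by (auto simp: \<delta>'_def min_def)
    moreover have "norm p * R < w x0"
      using p by (simp add: R_def)
    ultimately show False
      using le[OF \<open>x0 \<in> D\<close>] unfolding g_def[of x0] by linarith
  qed
  moreover have "w y \<le> w x + p \<bullet> (y - x) + \<delta>" if "x' \<in> \<Omega>" "y \<in> ball x' \<rho>" for x' y
  proof -
    have "g y < g x + \<delta>'"
      using that by (intro le) (auto simp: D_def)
    moreover have "\<delta>' \<le> \<delta>"
      by (simp add: \<delta>'_def)
    ultimately show ?thesis
      by (simp add: g_def inner_diff_right)
  qed
  ultimately show thesis
    by (rule that)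
qed

lemma integrable_indicator_ball_bounded:
  fixes h :: "'a::euclidean_space \<Rightarrow> real"
  assumes [measurable]: "h \<in> borel_measurable borel"
    and "\<And>y. y \<in> ball x r \<Longrightarrow> \<bar>h y\<bar> \<le> B"
  shows "integrable lborel (\<lambda>y. indicator (ball x r) y * h y)"
proof (rule Bochner_Integration.integrable_bound)
  show "integrable lborel (\<lambda>y. indicator (ball x r) y * B)"
    using emeasure_lborel_ball_finite[of x r]
    by (intro integrable_mult_left integrable_real_indicator) auto
  show "AE y in lborel. norm (indicator (ball x r) y * h y) \<le> norm (indicator (ball x r) y * B)"
    using assms(2) by (intro AE_I2) (fastforce simp: indicator_def)
qed (auto intro!: borel_measurable_times borel_measurable_indicator)

lemma integrable_affine_defect:
  fixes p :: "'a::euclidean_space"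
  assumes [measurable]: "w \<in> borel_measurable borel" and w: "\<And>y. 0 \<le> w y" "\<And>y. w y \<le> W"
  shows "integrable lborel (\<lambda>y. indicator (ball x r) y * (c + p \<bullet> (y - x') - w y))"
proof (rule integrable_indicator_ball_bounded)
  show "\<bar>c + p \<bullet> (y - x') - w y\<bar> \<le> \<bar>c\<bar> + norm p * (r + norm (x - x')) + W" if "y \<in> ball x r" for y
  proof -
    have "norm (y - x') \<le> norm (y - x) + norm (x - x')"
      by (metis dist_norm dist_triangle)
    also have "\<dots> \<le> r + norm (x - x')"
      using that by (simp add: dist_norm norm_minus_commute)
    finally have "norm p * norm (y - x') \<le> norm p * (r + norm (x - x'))"
      by (intro mult_left_mono) auto
    then show ?thesis
      using Cauchy_Schwarz_ineq2[of p "y - x'"] w[of y] by linarith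
  qed
qed simp

text \<open>By symmetry of \<open>\<mu>\<close> and of the ball, integrating the near-tangent affine function against either
  of them returns its value at the centre, so only the ball part of the dynamics sees the defect.\<close>

lemma contact_defect_integral:
  fixes \<mu> :: "(real ^ 'n) measure" and w :: "real ^ 'n \<Rightarrow> real"
  defines "m \<equiv> \<lambda>\<epsilon>. measure lborel (ball (0 :: real ^ 'n) \<epsilon>)"
  assumes \<mu>: "\<mu> \<in> sym_prob_measures \<Lambda>" and "\<Lambda> \<ge> 1" "\<epsilon> > 0" "\<alpha> \<ge> 0" "\<beta> > 0" "\<alpha> + \<beta> = 1"
    and wm[measurable]: "w \<in> borel_measurable borel" and w: "\<And>y. 0 \<le> w y" "\<And>y. w y \<le> W"
    and sub: "w x \<le> \<alpha> * (\<integral>z. w (x + \<epsilon> *\<^sub>R z) \<partial>\<mu>) +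
      \<beta> / m \<epsilon> * ((\<integral>y. indicator (ball x \<epsilon>) y * w y \<partial>lborel) + K)"
    and touch: "\<And>y. y \<in> ball x (\<Lambda> * \<epsilon>) \<Longrightarrow> w y \<le> w x + p \<bullet> (y - x) + \<delta>"
  shows "(\<integral>y. indicator (ball x \<epsilon>) y * (w x + \<delta> + p \<bullet> (y - x) - w y) \<partial>lborel) \<le> K + m \<epsilon> * \<delta> / \<beta>"
proof -
  have [measurable_cong]: "sets \<mu> = sets borel"
    using \<mu> by (auto simp: sym_prob_measures_def)
  interpret prob_space \<mu>
    using \<mu> by (auto simp: sym_prob_measures_def)
  have "m \<epsilon> > 0"
    using \<open>\<epsilon> > 0\<close> by (simp add: m_def)
  have m: "measure lborel (ball x \<epsilon>) = m \<epsilon>"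
    using \<open>\<epsilon> > 0\<close> by (simp add: m_def content_ball)
  define I where "I = (\<integral>y. indicator (ball x \<epsilon>) y * w y \<partial>lborel)"
  have int_w: "integrable lborel (\<lambda>y. indicator (ball x \<epsilon>) y * w y)"
    using w by (intro integrable_indicator_ball_bounded[where B = W]) (auto simp: abs_le_iff intro: order_trans[of _ 0])
  have "(\<integral>z. w (x + \<epsilon> *\<^sub>R z) \<partial>\<mu>) \<le> (\<integral>z. (w x + \<delta>) + \<epsilon> * (p \<bullet> z) \<partial>\<mu>)"
  proof (rule integral_mono_AE)
    show "integrable \<mu> (\<lambda>z. w (x + \<epsilon> *\<^sub>R z))"
      using w by (intro integrable_const_bound[where B = W]) auto
    show "integrable \<mu> (\<lambda>z. (w x + \<delta>) + \<epsilon> * (p \<bullet> z))"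
      using sym_prob_measures_inner[OF \<mu>] by auto
    show "AE z in \<mu>. w (x + \<epsilon> *\<^sub>R z) \<le> (w x + \<delta>) + \<epsilon> * (p \<bullet> z)"
      using AE_sym_prob_measures[OF \<mu>]
    proof eventually_elim
      case (elim z)
      then have "x + \<epsilon> *\<^sub>R z \<in> ball x (\<Lambda> * \<epsilon>)"
        using \<open>\<epsilon> > 0\<close> by (simp add: dist_norm mult.commute)
      from touch[OF this] show ?case
        by simp
    qed
  qed
  also have "\<dots> = w x + \<delta>"
    using sym_prob_measures_inner[OF \<mu>] prob_space by simp
  finally have "w x \<le> \<alpha> * (w x + \<delta>) + \<beta> / m \<epsilon> * (I + K)"
    using sub \<open>\<alpha> \<ge> 0\<close> unfolding I_def
    by (intro order_trans[OF sub] add_right_mono mult_left_mono)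
  \<comment> \<open>Splitting \<open>w x\<close> along \<open>\<alpha> + \<beta> = 1\<close> cancels
    its \<open>\<alpha>\<close>-part. Dividing the remainder by \<open>\<beta>\<close> leaves
    \<open>K\<close> with a coefficient free of \<open>\<beta>\<close>; only the slack
    \<open>\<delta>\<close> pays the factor \<open>1 / \<beta>\<close>.\<close>
  moreover have "w x = \<alpha> * w x + \<beta> * w x"
    using \<open>\<alpha> + \<beta> = 1\<close> by (simp flip: distrib_right)
  ultimately have "\<beta> * w x \<le> \<alpha> * \<delta> + \<beta> / m \<epsilon> * (I + K)"
    by (simp add: distrib_left[of \<alpha>])
  then have "m \<epsilon> / \<beta> * (\<beta> * w x) \<le> m \<epsilon> / \<beta> * (\<alpha> * \<delta> + \<beta> / m \<epsilon> * (I + K))"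
    using \<open>m \<epsilon> > 0\<close> \<open>\<beta> > 0\<close> by (intro mult_left_mono) auto
  moreover have "m \<epsilon> / \<beta> * (\<alpha> * \<delta> + \<beta> / m \<epsilon> * (I + K)) = m \<epsilon> * \<alpha> * \<delta> / \<beta> + I + K"
    using \<open>m \<epsilon> > 0\<close> \<open>\<beta> > 0\<close> by (simp add: field_simps)
  ultimately have main: "m \<epsilon> * w x \<le> m \<epsilon> * \<alpha> * \<delta> / \<beta> + I + K"
    using \<open>\<beta> > 0\<close> by simp
  \<comment> \<open>The \<open>- 0\<close> brings the affine part into the shape of
    \<open>integrable_affine_defect\<close> for the zero function.\<close>
  have "(\<integral>y. indicator (ball x \<epsilon>) y * (w x + \<delta> + p \<bullet> (y - x) - w y) \<partial>lborel) =
      (\<integral>y. indicator (ball x \<epsilon>) y * ((w x + \<delta>) + p \<bullet> (y - x) - 0) - indicator (ball x \<epsilon>) y * w y \<partial>lborel)"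
    by (intro Bochner_Integration.integral_cong) (auto simp: algebra_simps)
  also have "\<dots> = (\<integral>y. indicator (ball x \<epsilon>) y * ((w x + \<delta>) + p \<bullet> (y - x) - 0) \<partial>lborel) - I"
    unfolding I_def using int_w by (intro Bochner_Integration.integral_diff integrable_affine_defect[where W = 0]) auto
  also have "(\<integral>y. indicator (ball x \<epsilon>) y * ((w x + \<delta>) + p \<bullet> (y - x) - 0) \<partial>lborel) =
      (\<integral>y. indicator (ball x \<epsilon>) y * (w x + \<delta>) + indicator (ball x \<epsilon>) y * (0 + p \<bullet> (y - x) - 0) \<partial>lborel)"
    by (intro Bochner_Integration.integral_cong) (auto simp: algebra_simps)
  also have "\<dots> = (\<integral>y. indicator (ball x \<epsilon>) y * (w x + \<delta>) \<partial>lborel) + (\<integral>y. indicator (ball x \<epsilon>) y * (0 + p \<bullet> (y - x) - 0) \<partial>lborel)"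
    using emeasure_lborel_ball_finite[of x \<epsilon>]
    by (intro Bochner_Integration.integral_add integrable_affine_defect[where W = 0] integrable_mult_left integrable_real_indicator) auto
  also have "\<dots> = m \<epsilon> * (w x + \<delta>)"
    using integral_inner_ball_eq_0[of x \<epsilon> p] m by simp
  also have "m \<epsilon> * (w x + \<delta>) - I \<le> m \<epsilon> * \<alpha> * \<delta> / \<beta> + K + m \<epsilon> * \<delta>"
    using main by (simp add: algebra_simps)
  also have "\<dots> = K + m \<epsilon> * \<delta> * (\<alpha> + \<beta>) / \<beta>"
    using \<open>\<beta> > 0\<close> by (simp add: field_simps)
  finally show ?thesis
    by (simp add: \<open>\<alpha> + \<beta> = 1\<close>)
qed

text \<open>Both planes lie above \<open>w\<close>, so where both balls overlap, in particular on
  the ball of radius \<open>\<epsilon> / 2\<close> about \<open>x\<close>, the difference of the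
  planes is at most the sum of their defects. \<open>slope_le_integral\<close> turns this into a
  bound on the slopes; its ball of radius \<open>\<epsilon> / 8\<close> costs a factor 8 per
  dimension, and its factor \<open>\<epsilon> / 8\<close> one more.\<close>

lemma contact_slopes_close:
  fixes w :: "'a::euclidean_space \<Rightarrow> real"
  defines "J \<equiv> \<lambda>x p \<delta> \<epsilon>. (\<integral>y. indicator (ball x \<epsilon>) y * (w x + \<delta> + p \<bullet> (y - x) - w y) \<partial>lborel)"
  assumes "\<epsilon> > 0" "dist x x' \<le> \<epsilon> / 2"
    and wm[measurable]: "w \<in> borel_measurable borel" and w: "\<And>y. 0 \<le> w y" "\<And>y. w y \<le> W"
    and touch: "\<And>y. y \<in> ball x \<epsilon> \<Longrightarrow> w y \<le> w x + p \<bullet> (y - x) + \<delta>"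
      "\<And>y. y \<in> ball x' \<epsilon> \<Longrightarrow> w y \<le> w x' + p' \<bullet> (y - x') + \<delta>"
  shows "norm (p - p') * \<epsilon> * measure lborel (ball (0::'a) \<epsilon>) \<le>
    8 ^ (DIM('a) + 1) * (J x p \<delta> \<epsilon> + J x' p' \<delta> \<epsilon>)"
proof -
  define F where "F y = indicator (ball x \<epsilon>) y * (w x + \<delta> + p \<bullet> (y - x) - w y) +
    indicator (ball x' \<epsilon>) y * (w x' + \<delta> + p' \<bullet> (y - x') - w y)" for y
  have int: "integrable lborel (\<lambda>y. indicator (ball x \<epsilon>) y * (w x + \<delta> + p \<bullet> (y - x) - w y))" for x p
    using w by (intro integrable_affine_defect[where W = W]) auto
  have "norm (p - p') * (\<epsilon> / 2) / 4 * measure lborel (ball (0::'a) ((\<epsilon> / 2) / 4)) \<le> (\<integral>y. F y \<partial>lborel)"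
  proof (rule slope_le_integral)
    show "integrable lborel F"
      unfolding F_def by (intro Bochner_Integration.integrable_add int)
    have "0 \<le> indicator (ball x \<epsilon>) y * (w x + \<delta> + p \<bullet> (y - x) - w y)"
      "0 \<le> indicator (ball x' \<epsilon>) y * (w x' + \<delta> + p' \<bullet> (y - x') - w y)" for y
      using touch[of y] by (auto simp: indicator_def)
    then show "0 \<le> F y" for y
      by (simp add: F_def)
    fix y assume y: "y \<in> ball x (\<epsilon> / 2)"
    have "dist x' y \<le> dist x x' + dist x y"
      by (metis dist_triangle dist_commute)
    then have "y \<in> ball x \<epsilon>" "y \<in> ball x' \<epsilon>"
      using y assms by auto
    then show "\<bar>(w x - w x' - p' \<bullet> (x - x')) + (p - p') \<bullet> (y - x)\<bar> \<le> F y"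
      using touch[of y] by (simp add: F_def inner_diff_left inner_diff_right)
  qed (use \<open>\<epsilon> > 0\<close> in auto)
  also have "(\<integral>y. F y \<partial>lborel) = J x p \<delta> \<epsilon> + J x' p' \<delta> \<epsilon>"
    unfolding F_def J_def by (intro Bochner_Integration.integral_add int)
  finally show ?thesis
    using \<open>\<epsilon> > 0\<close> by (simp add: content_ball field_simps power_divide)
qed

section \<open>The ABP estimate\<close>

definition grid_index :: "real \<Rightarrow> real ^ 'n \<Rightarrow> 'n \<Rightarrow> int" where
  "grid_index s x = (\<lambda>i. \<lfloor>x $ i / s\<rfloor>)"

definition grid_point :: "real \<Rightarrow> ('n \<Rightarrow> int) \<Rightarrow> real ^ 'n" where
  "grid_point s k = (\<chi> i. s * of_int (k i))"

lemma dist_grid_point_le: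
  fixes x :: "real ^ 'n"
  assumes "s > 0"
  shows "dist x (grid_point s (grid_index s x)) \<le> real CARD('n) * s"
proof -
  have "\<bar>x $ i - s * of_int \<lfloor>x $ i / s\<rfloor>\<bar> \<le> s" for i
  proof -
    have "s * of_int \<lfloor>x $ i / s\<rfloor> \<le> s * (x $ i / s)" "s * (x $ i / s) \<le> s * (of_int \<lfloor>x $ i / s\<rfloor> + 1)"
      using assms by (intro mult_left_mono; linarith)+
    then show ?thesis
      using assms by (simp add: algebra_simps)
  qed
  then have "(\<Sum>i\<in>UNIV. \<bar>(x - grid_point s (grid_index s x)) $ i\<bar>) \<le> (\<Sum>i\<in>(UNIV::'n set). s)"
    by (intro sum_mono) (simp add: grid_point_def grid_index_def)
  then show ?thesis
    using norm_le_l1_cart[of "x - grid_point s (grid_index s x)"] by (simp add: dist_norm)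
qed

lemma grid_points_near:
  fixes y :: "real ^ 'n"
  assumes "s > 0"
  shows "{k. y \<in> ball (grid_point s k) (real n * s)} \<subseteq>
    PiE UNIV (\<lambda>i. {\<lfloor>y $ i / s\<rfloor> - int n .. \<lfloor>y $ i / s\<rfloor> + int n + 1})"
proof (intro subsetI PiE_I)
  fix k i assume "k \<in> {k. y \<in> ball (grid_point s k) (real n * s)}"
  then have "norm (y - grid_point s k) < real n * s"
    by (simp add: dist_norm norm_minus_commute)
  then have "\<bar>y $ i - s * of_int (k i)\<bar> < real n * s"
    using component_le_norm_cart[of "y - grid_point s k" i] by (simp add: grid_point_def)
  moreover have "y $ i - s * of_int (k i) = s * (y $ i / s - of_int (k i))"
    using assms by (simp add: algebra_simps)
  ultimately have "s * \<bar>y $ i / s - of_int (k i)\<bar> < s * real n"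
    using assms by (simp add: abs_mult mult.commute)
  then have "\<bar>y $ i / s - of_int (k i)\<bar> < real n"
    using assms by simp
  then have "of_int (k i) < y $ i / s + real n" "y $ i / s - real n < of_int (k i)"
    by linarith+
  then show "k i \<in> {\<lfloor>y $ i / s\<rfloor> - int n .. \<lfloor>y $ i / s\<rfloor> + int n + 1}"
    by (simp; linarith)
qed simp

text \<open>Each coordinate of \<open>k\<close> is confined to \<open>2 * n + 2\<close> integers.
  The count depends on the dimension and on the ratio \<open>n\<close> of radius to mesh, not on the
  mesh itself.\<close>

lemma card_grid_points_near:
  fixes y :: "real ^ 'n"
  assumes "s > 0"
  shows "card {k \<in> K. y \<in> ball (grid_point s k) (real n * s)} \<le> (2 * n + 2) ^ CARD('n)"
proof -
  let ?P = "PiE UNIV (\<lambda>i::'n. {\<lfloor>y $ i / s\<rfloor> - int n .. \<lfloor>y $ i / s\<rfloor> + int n + 1})"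
  have "card {k \<in> K. y \<in> ball (grid_point s k) (real n * s)} \<le> card ?P"
    using grid_points_near[OF assms, of y n] by (intro card_mono finite_PiE) auto
  also have "\<dots> = (\<Prod>i\<in>(UNIV :: 'n set). 2 * n + 2)"
    by (subst card_PiE) (auto intro!: prod.cong simp: nat_add_distrib nat_mult_distrib)
  finally show ?thesis
    by simp
qed

lemma finite_grid_index_image:
  fixes A :: "(real ^ 'n) set"
  assumes "bounded A" "s > 0"
  shows "finite (grid_index s ` A)"
proof -
  obtain b where b: "\<And>x. x \<in> A \<Longrightarrow> norm x \<le> b"
    using assms(1) by (auto simp: bounded_iff)
  have "grid_index s ` A \<subseteq> PiE UNIV (\<lambda>_. {\<lfloor>- b / s\<rfloor> .. \<lfloor>b / s\<rfloor>})"
  proof (intro image_subsetI PiE_I)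
    fix x i assume "x \<in> A"
    then have "\<bar>x $ i\<bar> \<le> b"
      using b[of x] component_le_norm_cart[of x i] by linarith
    then have "- b / s \<le> x $ i / s" "x $ i / s \<le> b / s"
      using assms(2) by (intro divide_right_mono; linarith)+
    then show "grid_index s x i \<in> {\<lfloor>- b / s\<rfloor> .. \<lfloor>b / s\<rfloor>}"
      by (auto simp: grid_index_def intro!: floor_mono)
  qed simp
  then show ?thesis
    by (rule finite_subset) (auto intro!: finite_PiE)
qed

section \<open>Covering the ball of slopes and comparing volumes\<close>

lemma ball_covered_power_le:
  fixes c :: "'k \<Rightarrow> 'a::euclidean_space"
  assumes "finite K" "r > 0" "\<And>k. k \<in> K \<Longrightarrow> 0 \<le> R k" "ball 0 r \<subseteq> (\<Union>k\<in>K. cball (c k) (R k))"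
  shows "r ^ DIM('a) \<le> (\<Sum>k\<in>K. R k ^ DIM('a))"
proof -
  have "cball (c k) (R k) \<in> fmeasurable lborel" for k
    using emeasure_lborel_cball_finite by (intro fmeasurableI) auto
  then have "measure lborel (ball (0::'a) r) \<le> measure lborel (\<Union>k\<in>K. cball (c k) (R k))"
    using assms by (intro measure_mono_fmeasurable fmeasurable.finite_UN) auto
  also have "\<dots> \<le> (\<Sum>k\<in>K. measure lborel (cball (c k) (R k)))"
    using assms(1) by (intro measure_UNION_le) auto
  also have "\<dots> = unit_ball_vol DIM('a) * (\<Sum>k\<in>K. R k ^ DIM('a))"
    using assms(3) by (simp add: content_cball sum_distrib_left)
  finally show ?thesis
    using \<open>r > 0\<close> by (simp add: content_ball)
qed

text \<open>A discrete form of Aleksandrov's argument. Every slope \<open>p\<close> with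
  \<open>norm p * (diameter \<Omega> + \<Lambda> * \<epsilon>) < w x0\<close> has a near-contact
  point \<open>X p\<close>, and slopes whose contact points share a grid cell differ little, so one
  small ball per cell covers all slopes. The parameter \<open>\<eta>\<close> absorbs the slack of
  near-contact.\<close>

lemma abp_covering:
  fixes w f :: "real ^ 'n \<Rightarrow> real" and \<nu> :: "real ^ 'n \<Rightarrow> (real ^ 'n) measure"
    and \<epsilon> :: real
  defines "m \<equiv> measure lborel (ball (0 :: real ^ 'n) \<epsilon>)"
    and "N \<equiv> CARD('n)"
  assumes \<nu>: "\<And>x. x \<in> \<Omega> \<Longrightarrow> \<nu> x \<in> sym_prob_measures \<Lambda>"
    and par: "\<Lambda> \<ge> 1" "\<epsilon> > 0" "\<alpha> \<ge> 0" "\<beta> > 0" "\<alpha> + \<beta> = 1"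
    and \<Omega>: "bounded \<Omega>" "x0 \<in> \<Omega>"
    and wm[measurable]: "w \<in> borel_measurable borel" and w: "\<And>y. 0 \<le> w y" "\<And>y. w y \<le> W"
      "\<And>y. y \<notin> \<Omega> \<Longrightarrow> w y = 0" "w x0 > 0"
    and f: "integrable lborel f" "\<And>y. 0 \<le> f y"
    and sub: "\<And>x. x \<in> \<Omega> \<Longrightarrow> w x \<le> \<alpha> * (\<integral>z. w (x + \<epsilon> *\<^sub>R z) \<partial>\<nu> x) +
      \<beta> / m * ((\<integral>y. indicator (ball x \<epsilon>) y * w y \<partial>lborel) +
        \<epsilon>\<^sup>2 * (\<integral>y. indicator (ball x \<epsilon>) y * f y \<partial>lborel))"
    and "\<eta> > 0"
  defines "a \<equiv> \<lambda>k. (\<integral>y. indicator (ball (grid_point (\<epsilon> / (4 * N)) k) (2 * \<epsilon>)) y * f y \<partial>lborel) / m"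
  shows "(w x0 / (diameter \<Omega> + \<Lambda> * \<epsilon>)) ^ N \<le>
    (\<Sum>k\<in>grid_index (\<epsilon> / (4 * N)) ` \<Omega>. (2 * 8 ^ (N + 1) * (\<epsilon> * a k + \<eta>)) ^ N)"
proof -
  \<comment> \<open>The mesh \<open>s\<close> puts points of a cell within
    \<open>\<epsilon> / 4\<close> of its corner, hence within \<open>\<epsilon> / 2\<close> of each
    other, as \<open>contact_slopes_close\<close> asks. The choice of \<open>\<delta>\<close> turns
    the error \<open>m * \<delta> / \<beta>\<close> into
    \<open>m * \<epsilon> * \<eta>\<close>.\<close>
  define s R \<delta> where "s = \<epsilon> / (4 * N)" and "R = diameter \<Omega> + \<Lambda> * \<epsilon>" and "\<delta> = \<eta> * \<beta> * \<epsilon>"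
  define K where "K = grid_index s ` \<Omega>"
  define rad where "rad k = 2 * 8 ^ (N + 1) * (\<epsilon> * a k + \<eta>)" for k
  define J where "J x p = (\<integral>y. indicator (ball x \<epsilon>) y * (w x + \<delta> + p \<bullet> (y - x) - w y) \<partial>lborel)" for x p
  have "s > 0" "m > 0" "\<delta> > 0" "\<Lambda> * \<epsilon> \<ge> \<epsilon>"
    using par \<open>\<eta> > 0\<close> by (auto simp: s_def m_def N_def \<delta>_def)
  then have "R > 0"
    using diameter_ge_0[OF \<Omega>(1)] \<open>\<epsilon> > 0\<close> unfolding R_def by linarith
  have near: "dist x (grid_point s (grid_index s x)) \<le> \<epsilon> / 4" for x :: "real ^ 'n"
    using dist_grid_point_le[OF \<open>s > 0\<close>, of x] by (simp add: s_def N_def)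
  have int_f: "integrable lborel (\<lambda>y. indicator (ball x r) y * f y)" for x :: "real ^ 'n" and r
    using integrable_mult_indicator[OF _ f(1), of "ball x r"] by simp
  have a_nonneg: "a k \<ge> 0" for k
    using f \<open>m > 0\<close> by (auto simp: a_def intro!: divide_nonneg_nonneg integral_nonneg)
  \<comment> \<open>The ball of radius \<open>2 * \<epsilon>\<close> about the corner contains the
    \<open>\<epsilon>\<close>-ball about every point of the cell, so the single number
    \<open>a k\<close> serves all contact points in that cell.\<close>
  have a_ge: "(\<integral>y. indicator (ball x \<epsilon>) y * f y \<partial>lborel) \<le> m * a (grid_index s x)" for x
  proof -
    have "ball x \<epsilon> \<subseteq> ball (grid_point s (grid_index s x)) (2 * \<epsilon>)"
    proof
      fix y assume "y \<in> ball x \<epsilon>"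
      moreover have "dist (grid_point s (grid_index s x)) y \<le> dist (grid_point s (grid_index s x)) x + dist x y"
        by (rule dist_triangle)
      ultimately show "y \<in> ball (grid_point s (grid_index s x)) (2 * \<epsilon>)"
        using near[of x] \<open>\<epsilon> > 0\<close> by (simp add: dist_commute)
    qed
    then have "(\<integral>y. indicator (ball x \<epsilon>) y * f y \<partial>lborel) \<le>
        (\<integral>y. indicator (ball (grid_point s (grid_index s x)) (2 * \<epsilon>)) y * f y \<partial>lborel)"
      using f by (intro integral_mono int_f mult_right_mono) (auto simp: indicator_def)
    then show ?thesis
      using \<open>m > 0\<close> by (simp add: a_def s_def)
  qed
  have "\<forall>p\<in>ball 0 (w x0 / R). \<exists>x\<in>\<Omega>. \<forall>x'\<in>\<Omega>. \<forall>y\<in>ball x' (\<Lambda> * \<epsilon>). w y \<le> w x + p \<bullet> (y - x) + \<delta>"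
  proof
    fix p :: "real ^ 'n" assume "p \<in> ball 0 (w x0 / R)"
    then have "norm p * (diameter \<Omega> + \<Lambda> * \<epsilon>) < w x0"
      using \<open>R > 0\<close> by (simp add: R_def field_simps)
    moreover have "\<Lambda> * \<epsilon> > 0"
      using par by simp
    ultimately obtain x where "x \<in> \<Omega>"
      "\<And>x' y. x' \<in> \<Omega> \<Longrightarrow> y \<in> ball x' (\<Lambda> * \<epsilon>) \<Longrightarrow> w y \<le> w x + p \<bullet> (y - x) + \<delta>"
      using near_contact_point[OF \<Omega>, of "\<Lambda> * \<epsilon>" \<delta> w W p] \<open>\<delta> > 0\<close> w by blast
    then show "\<exists>x\<in>\<Omega>. \<forall>x'\<in>\<Omega>. \<forall>y\<in>ball x' (\<Lambda> * \<epsilon>). w y \<le> w x + p \<bullet> (y - x) + \<delta>"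
      by blast
  qed
  then obtain X where X: "\<And>p. p \<in> ball 0 (w x0 / R) \<Longrightarrow> X p \<in> \<Omega>"
    "\<And>p x' y. p \<in> ball 0 (w x0 / R) \<Longrightarrow> x' \<in> \<Omega> \<Longrightarrow> y \<in> ball x' (\<Lambda> * \<epsilon>) \<Longrightarrow>
      w y \<le> w (X p) + p \<bullet> (y - X p) + \<delta>"
    by metis
  have J_le: "J (X p) p \<le> m * (\<epsilon>\<^sup>2 * a (grid_index s (X p)) + \<epsilon> * \<eta>)" if p: "p \<in> ball 0 (w x0 / R)" for p
  proof -
    have "J (X p) p \<le> \<epsilon>\<^sup>2 * (\<integral>y. indicator (ball (X p) \<epsilon>) y * f y \<partial>lborel) + m * \<delta> / \<beta>"
      unfolding J_def m_def
      by (rule contact_defect_integral[OF \<nu>[OF X(1)[OF p]] par wm w(1,2)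
            sub[OF X(1)[OF p], unfolded m_def] X(2)[OF p X(1)[OF p]]])
    also have "\<dots> \<le> \<epsilon>\<^sup>2 * (m * a (grid_index s (X p))) + m * \<delta> / \<beta>"
      by (intro add_right_mono mult_left_mono a_ge) auto
    also have "\<dots> = m * (\<epsilon>\<^sup>2 * a (grid_index s (X p)) + \<epsilon> * \<eta>)"
      using \<open>\<beta> > 0\<close> by (simp add: \<delta>_def algebra_simps)
    finally show ?thesis .
  qed
  have close: "norm (p - p') \<le> rad k"
    if p: "p \<in> ball 0 (w x0 / R)" "grid_index s (X p) = k"
      "p' \<in> ball 0 (w x0 / R)" "grid_index s (X p') = k" for p p' k
  proof -
    have "dist (X p) (X p') \<le> dist (X p) (grid_point s k) + dist (X p') (grid_point s k)"
      by (rule dist_triangle2)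
    then have "dist (X p) (X p') \<le> \<epsilon> / 2"
      using near[of "X p"] near[of "X p'"] p by simp
    moreover have "w y \<le> w (X q) + q \<bullet> (y - X q) + \<delta>" if "q \<in> ball 0 (w x0 / R)" "y \<in> ball (X q) \<epsilon>" for q y
      using that \<open>\<Lambda> * \<epsilon> \<ge> \<epsilon>\<close> by (intro X(2)[OF that(1) X(1)]) auto
    ultimately have "norm (p - p') * \<epsilon> * m \<le> 8 ^ (DIM(real ^ 'n) + 1) * (J (X p) p + J (X p') p')"
      unfolding J_def m_def using p w \<open>\<epsilon> > 0\<close> wm by (intro contact_slopes_close) auto
    also have "\<dots> \<le> 8 ^ (DIM(real ^ 'n) + 1) * (2 * (m * (\<epsilon>\<^sup>2 * a k + \<epsilon> * \<eta>)))"
      using J_le[OF p(1)] J_le[OF p(3)] p by (intro mult_left_mono) auto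
    also have "\<dots> = rad k * \<epsilon> * m"
      by (simp add: rad_def N_def algebra_simps power2_eq_square)
    finally show ?thesis
      using \<open>m > 0\<close> \<open>\<epsilon> > 0\<close> by simp
  qed
  \<comment> \<open>\<open>Eps (Q k)\<close> selects one slope per cell as the centre of the
    covering ball. A cell reached by no slope gets an arbitrary centre and merely enlarges the
    union.\<close>
  define Q where "Q k p \<longleftrightarrow> p \<in> ball 0 (w x0 / R) \<and> grid_index s (X p) = k" for k p
  have "(w x0 / R) ^ DIM(real ^ 'n) \<le> (\<Sum>k\<in>K. rad k ^ DIM(real ^ 'n))"
  proof (rule ball_covered_power_le)
    show "ball 0 (w x0 / R) \<subseteq> (\<Union>k\<in>K. cball (Eps (Q k)) (rad k))"
    proof
      fix p :: "real ^ 'n" assume p: "p \<in> ball 0 (w x0 / R)"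
      define k where "k = grid_index s (X p)"
      have "Q k p"
        unfolding Q_def k_def using p by blast
      then have "Q k (Eps (Q k))"
        by (rule someI)
      then have "norm (Eps (Q k) - p) \<le> rad k"
        using \<open>Q k p\<close> unfolding Q_def[of _ "Eps (Q k)"] Q_def[of _ p] by (intro close) blast+
      then have "p \<in> cball (Eps (Q k)) (rad k)"
        by (simp add: dist_norm)
      moreover have "k \<in> K"
        using X(1)[OF p] by (simp add: k_def K_def)
      ultimately show "p \<in> (\<Union>k\<in>K. cball (Eps (Q k)) (rad k))"
        by blast
    qed
    show "finite K"
      unfolding K_def by (intro finite_grid_index_image \<Omega> \<open>s > 0\<close>)
    show "0 \<le> rad k" for k
      using a_nonneg[of k] \<open>\<eta> > 0\<close> \<open>\<epsilon> > 0\<close> by (simp add: rad_def)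
  qed (use w \<open>R > 0\<close> in auto)
  then show ?thesis
    by (simp add: R_def K_def rad_def s_def N_def)
qed

text \<open>The first factor stems from the radii of the covering balls,
  \<open>2 ^ (n * (n - 1))\<close> from Jensen's inequality on balls of radius
  \<open>2 * \<epsilon>\<close>, \<open>(16 * real n + 2) ^ n\<close> from the overlap of these
  balls, and the unit ball volume from the normalisation by the volume of an
  \<open>\<epsilon>\<close>-ball.\<close>

definition abp_constant :: "nat \<Rightarrow> real" where
  "abp_constant n = (2 * 8 ^ (n + 1)) ^ n * (2 ^ (n * (n - 1)) * (16 * real n + 2) ^ n / unit_ball_vol n)"

lemma abp_constant_pos: "abp_constant n > 0"
  by (auto simp: abp_constant_def intro!: mult_pos_pos divide_pos_pos add_nonneg_pos)

text \<open>Jensen's inequality bounds each term by the integral of \<open>f y ^ N\<close> over one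
  ball, and every point lies in a bounded number of these balls.\<close>

lemma grid_averages_power_le:
  fixes f :: "real ^ 'n \<Rightarrow> real" and \<epsilon> :: real
  defines "N \<equiv> CARD('n)" and "m \<equiv> measure lborel (ball (0 :: real ^ 'n) \<epsilon>)"
  assumes "\<epsilon> > 0" "finite K" and f: "integrable lborel f" "integrable lborel (\<lambda>y. f y ^ N)" "\<And>y. 0 \<le> f y"
  defines "a \<equiv> \<lambda>k. (\<integral>y. indicator (ball (grid_point (\<epsilon> / (4 * N)) k) (2 * \<epsilon>)) y * f y \<partial>lborel) / m"
  shows "(\<Sum>k\<in>K. (\<epsilon> * a k) ^ N) \<le>
    2 ^ (N * (N - 1)) * (16 * real N + 2) ^ N / unit_ball_vol N * (\<integral>y. f y ^ N \<partial>lborel)"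
proof -
  define s where "s = \<epsilon> / (4 * N)"
  define S where "S k = ball (grid_point s k) (2 * \<epsilon>)" for k :: "'n \<Rightarrow> int"
  define V where "V = unit_ball_vol N"
  have "N \<ge> 1"
    by (simp add: N_def Suc_leI)
  have "s > 0" "m > 0" "V > 0"
    using \<open>\<epsilon> > 0\<close> \<open>N \<ge> 1\<close> by (auto simp: s_def m_def V_def)
  have m: "m = V * \<epsilon> ^ N"
    using \<open>\<epsilon> > 0\<close> by (simp add: m_def content_ball V_def N_def)
  have mS: "measure lborel (S k) = 2 ^ N * m" for k
    using \<open>\<epsilon> > 0\<close> by (simp add: S_def content_ball m V_def N_def power_mult_distrib)
  have Sm[measurable]: "S k \<in> sets borel" for k
    by (simp add: S_def)
  have int: "integrable lborel (\<lambda>y. indicator (S k) y * f y)" "integrable lborel (\<lambda>y. indicator (S k) y * f y ^ N)" for k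
    using integrable_mult_indicator[OF _ f(1), of "S k"] integrable_mult_indicator[OF _ f(2), of "S k"] Sm by simp_all
  have single: "(\<epsilon> * a k) ^ N \<le> 2 ^ (N * (N - 1)) / V * (\<integral>y. indicator (S k) y * f y ^ N \<partial>lborel)" for k
  proof -
    have "(\<integral>y. indicator (S k) y * f y \<partial>lborel) ^ N \<le>
        (2 ^ N * m) ^ (N - 1) * (\<integral>y. indicator (S k) y * f y ^ N \<partial>lborel)"
      using integral_power_le[OF \<open>N \<ge> 1\<close> f(3) int(1) int(2), of k] \<open>m > 0\<close>
        emeasure_lborel_ball_finite[of "grid_point s k" "2 * \<epsilon>"]
      by (simp add: mS) (simp add: S_def)
    then have "(\<epsilon> * a k) ^ N \<le> (\<epsilon> / m) ^ N * ((2 ^ N * m) ^ (N - 1) * (\<integral>y. indicator (S k) y * f y ^ N \<partial>lborel))"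
      using \<open>m > 0\<close> \<open>\<epsilon> > 0\<close>
      by (simp add: a_def S_def s_def power_mult_distrib power_divide divide_right_mono)
    also have "\<dots> = (\<epsilon> / m) ^ N * (2 ^ N * m) ^ (N - 1) * (\<integral>y. indicator (S k) y * f y ^ N \<partial>lborel)"
      by simp
    \<comment> \<open>Since \<open>m\<close> is proportional to \<open>\<epsilon> ^ N\<close>, the
      scale cancels for precisely this exponent; this is why the norm with exponent \<open>N\<close>
      appears.\<close>
    also have "(\<epsilon> / m) ^ N * (2 ^ N * m) ^ (N - 1) = 2 ^ (N * (N - 1)) * \<epsilon> ^ N / m"
      using \<open>N \<ge> 1\<close> \<open>m > 0\<close> by (cases N) (auto simp: power_mult_distrib power_divide power_mult[symmetric] power_add)
    also have "\<dots> = 2 ^ (N * (N - 1)) / V"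
      using \<open>\<epsilon> > 0\<close> by (simp add: m)
    finally show ?thesis .
  qed
  have overlap: "(\<Sum>k\<in>K. indicator (S k) y) \<le> (16 * real N + 2) ^ N" for y
  proof -
    \<comment> \<open>The radius \<open>2 * \<epsilon>\<close> is \<open>8 * N\<close> times the
      mesh \<open>s\<close>, which gives the count \<open>16 * N + 2\<close> per coordinate.\<close>
    have "card {k \<in> K. y \<in> ball (grid_point s k) (real (8 * N) * s)} \<le> (2 * (8 * N) + 2) ^ N"
      unfolding N_def by (rule card_grid_points_near) (use \<open>s > 0\<close> in \<open>simp add: N_def\<close>)
    moreover have "real (8 * N) * s = 2 * \<epsilon>"
      using \<open>N \<ge> 1\<close> by (simp add: s_def)
    moreover have "K \<inter> {k. y \<in> S k} = {k \<in> K. y \<in> S k}"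
      by blast
    ultimately have "card (K \<inter> {k. y \<in> S k}) \<le> (2 * (8 * N) + 2) ^ N"
      by (simp only: S_def)
    then have "real (card (K \<inter> {k. y \<in> S k})) \<le> real ((2 * (8 * N) + 2) ^ N)"
      by (simp only: of_nat_le_iff)
    moreover have "(\<Sum>k\<in>K. indicator (S k) y) = real (card (K \<inter> {k. y \<in> S k}))"
      using \<open>finite K\<close> by (simp add: indicator_def)
    ultimately show ?thesis
      by (simp add: add.commute)
  qed
  have "(\<Sum>k\<in>K. \<integral>y. indicator (S k) y * f y ^ N \<partial>lborel) = (\<integral>y. (\<Sum>k\<in>K. indicator (S k) y * f y ^ N) \<partial>lborel)"
    using int by simp
  also have "\<dots> \<le> (\<integral>y. (16 * real N + 2) ^ N * f y ^ N \<partial>lborel)"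
  proof (rule integral_mono)
    show "(\<Sum>k\<in>K. indicator (S k) y * f y ^ N) \<le> (16 * real N + 2) ^ N * f y ^ N" for y
      unfolding sum_distrib_right[symmetric] using f(3) by (intro mult_right_mono overlap) auto
  qed (use int f in auto)
  finally have tot: "(\<Sum>k\<in>K. \<integral>y. indicator (S k) y * f y ^ N \<partial>lborel) \<le> (16 * real N + 2) ^ N * (\<integral>y. f y ^ N \<partial>lborel)"
    by simp
  have "(\<Sum>k\<in>K. (\<epsilon> * a k) ^ N) \<le> 2 ^ (N * (N - 1)) / V * (\<Sum>k\<in>K. \<integral>y. indicator (S k) y * f y ^ N \<partial>lborel)"
    unfolding sum_distrib_left by (intro sum_mono single)
  also have "\<dots> \<le> 2 ^ (N * (N - 1)) / V * ((16 * real N + 2) ^ N * (\<integral>y. f y ^ N \<partial>lborel))"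
    using \<open>V > 0\<close> by (intro mult_left_mono tot) auto
  finally show ?thesis
    by (simp add: V_def)
qed

text \<open>Letting the slack in \<open>abp_covering\<close> tend to 0 and taking
  \<open>N\<close>-th roots. The upper bound \<open>W\<close> of \<open>w\<close> does not enter the
  result, so it may be as crude as desired.\<close>

lemma abp_estimate:
  fixes w f :: "real ^ 'n \<Rightarrow> real" and \<nu> :: "real ^ 'n \<Rightarrow> (real ^ 'n) measure" and \<epsilon> :: real
  defines "m \<equiv> measure lborel (ball (0 :: real ^ 'n) \<epsilon>)" and "N \<equiv> CARD('n)"
  assumes \<nu>: "\<And>x. x \<in> \<Omega> \<Longrightarrow> \<nu> x \<in> sym_prob_measures \<Lambda>"
    and par: "\<Lambda> \<ge> 1" "\<epsilon> > 0" "\<alpha> \<ge> 0" "\<beta> > 0" "\<alpha> + \<beta> = 1"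
    and \<Omega>: "bounded \<Omega>" "x0 \<in> \<Omega>"
    and wm: "w \<in> borel_measurable borel" and w: "\<And>y. 0 \<le> w y" "\<And>y. w y \<le> W"
      "\<And>y. y \<notin> \<Omega> \<Longrightarrow> w y = 0"
    and f: "integrable lborel f" "integrable lborel (\<lambda>y. f y ^ N)" "\<And>y. 0 \<le> f y"
    and sub: "\<And>x. x \<in> \<Omega> \<Longrightarrow> w x \<le> \<alpha> * (\<integral>z. w (x + \<epsilon> *\<^sub>R z) \<partial>\<nu> x) +
      \<beta> / m * ((\<integral>y. indicator (ball x \<epsilon>) y * w y \<partial>lborel) +
        \<epsilon>\<^sup>2 * (\<integral>y. indicator (ball x \<epsilon>) y * f y \<partial>lborel))"
  shows "w x0 \<le> abp_constant N powr (1 / N) * (diameter \<Omega> + \<Lambda> * \<epsilon>) *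
    (\<integral>y. f y ^ N \<partial>lborel) powr (1 / N)"
proof (cases "w x0 > 0")
  case False
  have "diameter \<Omega> + \<Lambda> * \<epsilon> \<ge> 0"
    using diameter_ge_0[OF \<Omega>(1)] par by simp
  then show ?thesis
    using False by (smt (verit) mult_nonneg_nonneg powr_ge_zero)
next
  case True
  define R K where "R = diameter \<Omega> + \<Lambda> * \<epsilon>" and "K = grid_index (\<epsilon> / (4 * N)) ` \<Omega>"
  define A :: real where "A = 2 * 8 ^ (N + 1)"
  define a where "a k = (\<integral>y. indicator (ball (grid_point (\<epsilon> / (4 * N)) k) (2 * \<epsilon>)) y * f y \<partial>lborel) / m"
    for k :: "'n \<Rightarrow> int"
  have "N \<ge> 1"
    by (simp add: N_def Suc_leI)
  have "R > 0"
    using diameter_ge_0[OF \<Omega>(1)] par by (simp add: R_def add_nonneg_pos)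
  have K: "finite K"
    using \<open>N \<ge> 1\<close> par by (auto simp: K_def intro!: finite_grid_index_image \<Omega>)
  have cover: "(w x0 / R) ^ N \<le> (\<Sum>k\<in>K. (A * (\<epsilon> * a k + \<eta>)) ^ N)" if "\<eta> > 0" for \<eta>
    unfolding R_def K_def A_def a_def m_def N_def
    by (rule abp_covering[OF \<nu> par \<Omega> wm w True f(1,3) sub[unfolded m_def] that])
  \<comment> \<open>The index set \<open>K\<close> is finite and fixed while \<open>\<eta>\<close>
    varies, so the right-hand side is continuous in \<open>\<eta>\<close>.\<close>
  have lim: "((\<lambda>\<eta>. \<Sum>k\<in>K. (A * (\<epsilon> * a k + \<eta>)) ^ N) \<longlongrightarrow> (\<Sum>k\<in>K. (A * (\<epsilon> * a k + 0)) ^ N)) (at_right 0)"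
    by (intro tendsto_intros)
  have "(w x0 / R) ^ N \<le> (\<Sum>k\<in>K. (A * (\<epsilon> * a k + 0)) ^ N)"
    by (rule tendsto_lowerbound[OF lim])
      (use cover in \<open>auto simp: eventually_at_right_less intro: eventually_mono[OF eventually_at_right_less]\<close>)
  also have "\<dots> = A ^ N * (\<Sum>k\<in>K. (\<epsilon> * a k) ^ N)"
    by (simp add: power_mult_distrib sum_distrib_left)
  also have "\<dots> \<le> A ^ N * (2 ^ (N * (N - 1)) * (16 * real N + 2) ^ N / unit_ball_vol N * (\<integral>y. f y ^ N \<partial>lborel))"
    unfolding a_def m_def N_def using f par K
    by (intro mult_left_mono grid_averages_power_le) (auto simp: A_def N_def)
  also have "\<dots> = abp_constant N * (\<integral>y. f y ^ N \<partial>lborel)"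
    by (simp add: abp_constant_def A_def)
  finally have "((w x0 / R) ^ N) powr (1 / N) \<le> (abp_constant N * (\<integral>y. f y ^ N \<partial>lborel)) powr (1 / N)"
    using True \<open>R > 0\<close> by (intro powr_mono2) auto
  moreover have "((w x0 / R) ^ N) powr (1 / N) = w x0 / R"
    using True \<open>R > 0\<close> \<open>N \<ge> 1\<close> by (simp add: powr_realpow[symmetric] powr_powr)
  ultimately show ?thesis
    using \<open>R > 0\<close> f abp_constant_pos[of N]
    by (simp add: powr_mult R_def[symmetric] pos_divide_le_eq mult_ac)
qed

section \<open>The chain and its one-step operator\<close>

text \<open>The weights are kept independent, so that \<open>chain_op \<alpha> 0\<close> and
  \<open>chain_op 0 \<beta>\<close> denote the contributions of \<open>\<nu>\<close> and of the
  uniform ball step. Values in \<open>ennreal\<close> allow monotone limits without integrability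
  conditions.\<close>

definition chain_op ::
  "real \<Rightarrow> real \<Rightarrow> real \<Rightarrow> (real ^ 'n \<Rightarrow> (real ^ 'n) measure) \<Rightarrow> (real ^ 'n \<Rightarrow> ennreal) \<Rightarrow> real ^ 'n \<Rightarrow> ennreal" where
  "chain_op \<alpha> \<beta> \<epsilon> \<nu> u x = ennreal \<alpha> * (\<integral>\<^sup>+z. u (x + \<epsilon> *\<^sub>R z) \<partial>\<nu> x) +
     ennreal (\<beta> / measure lborel (ball (0 :: real ^ 'n) \<epsilon>)) * (\<integral>\<^sup>+y. indicator (ball x \<epsilon>) y * u y \<partial>lborel)"

section \<open>Measurability and linearity of the one-step operator\<close>

lemma admissible_family_sets:
  "admissible_family \<Lambda> \<nu> \<Longrightarrow> sets (\<nu> x) = sets borel" "admissible_family \<Lambda> \<nu> \<Longrightarrow> prob_space (\<nu> x)"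
  by (auto simp: admissible_family_def sym_prob_measures_def)

text \<open>Admissibility, tested on indicators, says that the laws of \<open>x + z\<close> form a
  measurable kernel. Kernels give access to integrals whose integrand depends on \<open>x\<close> as
  well.\<close>

lemma measurable_translated_kernel:
  fixes \<nu> :: "real ^ 'n \<Rightarrow> (real ^ 'n) measure"
  assumes \<nu>: "admissible_family \<Lambda> \<nu>"
  shows "(\<lambda>x. distr (\<nu> x) borel (\<lambda>z. x + z)) \<in> borel \<rightarrow>\<^sub>M subprob_algebra borel"
proof (rule measurable_subprob_algebra)
  note [measurable_cong] = admissible_family_sets(1)[OF \<nu>]
  show "subprob_space (distr (\<nu> x) borel (\<lambda>z. x + z))" for x
    by (intro prob_space_imp_subprob_space prob_space.prob_space_distr admissible_family_sets[OF \<nu>]) simp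
  fix A :: "(real ^ 'n) set" assume A[measurable]: "A \<in> sets borel"
  have int: "integrable (\<nu> x) (\<lambda>z. indicator A (x + z) :: real)" for x
  proof -
    interpret prob_space "\<nu> x"
      by (rule admissible_family_sets[OF \<nu>])
    show ?thesis
      by (intro integrable_const_bound[where B = 1]) auto
  qed
  have "emeasure (distr (\<nu> x) borel (\<lambda>z. x + z)) A = ennreal (\<integral>z. indicator A (x + z) \<partial>\<nu> x)" for x
  proof -
    have "emeasure (distr (\<nu> x) borel (\<lambda>z. x + z)) A = (\<integral>\<^sup>+z. indicator A z \<partial>distr (\<nu> x) borel (\<lambda>z. x + z))"
      by simp
    also have "\<dots> = (\<integral>\<^sup>+z. indicator A (x + z) \<partial>\<nu> x)"
      by (rule nn_integral_distr) simp_all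
    also have "\<dots> = (\<integral>\<^sup>+z. ennreal (indicator A (x + z)) \<partial>\<nu> x)"
      by (intro nn_integral_cong) (simp split: split_indicator)
    also have "\<dots> = ennreal (\<integral>z. indicator A (x + z) \<partial>\<nu> x)"
      by (rule nn_integral_eq_integral[OF int]) simp
    finally show ?thesis .
  qed
  moreover have "(\<lambda>x. \<integral>z. indicator A (x + z) \<partial>\<nu> x :: real) \<in> borel_measurable borel"
    using \<nu> int unfolding admissible_family_def by fastforce
  ultimately show "(\<lambda>x. emeasure (distr (\<nu> x) borel (\<lambda>z. x + z)) A) \<in> borel_measurable borel"
    by simp
qed simp

text \<open>Admissibility only speaks about \<open>u (x + z)\<close>; the scaled increment is reached by viewing
  \<open>x + \<epsilon> *\<^sub>R z\<close> as a function of the pair \<open>(x, x + z)\<close>.\<close>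

lemma measurable_chain_op:
  fixes \<nu> :: "real ^ 'n \<Rightarrow> (real ^ 'n) measure"
  assumes \<nu>: "admissible_family \<Lambda> \<nu>" and [measurable]: "u \<in> borel_measurable borel"
  shows "chain_op \<alpha> \<beta> \<epsilon> \<nu> u \<in> borel_measurable borel"
proof -
  note [measurable_cong] = admissible_family_sets(1)[OF \<nu>]
  have "(\<lambda>x. \<integral>\<^sup>+y. u (x + \<epsilon> *\<^sub>R (y - x)) \<partial>distr (\<nu> x) borel (\<lambda>z. x + z)) \<in> borel_measurable borel"
    by (rule nn_integral_measurable_subprob_algebra2[OF _ measurable_translated_kernel[OF \<nu>]]) measurable
  also have "(\<lambda>x. \<integral>\<^sup>+y. u (x + \<epsilon> *\<^sub>R (y - x)) \<partial>distr (\<nu> x) borel (\<lambda>z. x + z)) = (\<lambda>x. \<integral>\<^sup>+z. u (x + \<epsilon> *\<^sub>R z) \<partial>\<nu> x)"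
    by (intro ext, subst nn_integral_distr) auto
  finally have [measurable]: "(\<lambda>x. \<integral>\<^sup>+z. u (x + \<epsilon> *\<^sub>R z) \<partial>\<nu> x) \<in> borel_measurable borel" .
  have "(\<lambda>x. \<integral>\<^sup>+y. indicator {y. dist x y < \<epsilon>} y * u y \<partial>lborel) \<in> borel_measurable borel"
    by measurable
  then have [measurable]: "(\<lambda>x. \<integral>\<^sup>+y. indicator (ball x \<epsilon>) y * u y \<partial>lborel) \<in> borel_measurable borel"
    by (simp add: ball_def)
  show ?thesis
    unfolding chain_op_def by measurable
qed

lemma transition_prob_nonneg: "0 \<le> \<alpha> \<Longrightarrow> 0 \<le> \<beta> \<Longrightarrow> 0 \<le> transition_prob \<alpha> \<beta> \<epsilon> \<nu> x E"
  by (simp add: transition_prob_def)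

lemma chain_op_indicator:
  fixes \<nu> :: "real ^ 'n \<Rightarrow> (real ^ 'n) measure"
  assumes \<nu>: "admissible_family \<Lambda> \<nu>" and "\<alpha> \<ge> 0" "\<beta> \<ge> 0" "\<epsilon> > 0" and E[measurable]: "E \<in> sets borel"
  shows "chain_op \<alpha> \<beta> \<epsilon> \<nu> (indicator E) x = ennreal (transition_prob \<alpha> \<beta> \<epsilon> \<nu> x E)"
proof -
  note [measurable_cong] = admissible_family_sets(1)[OF \<nu>]
  interpret prob_space "\<nu> x"
    by (rule admissible_family_sets[OF \<nu>])
  have space: "space (\<nu> x) = UNIV"
    using sets_eq_imp_space_eq[OF admissible_family_sets(1)[OF \<nu>]] by simp
  \<comment> \<open>The image under the inverse affine map is a preimage, hence measurable; its
    \<open>measure\<close> is therefore the integral of an indicator.\<close>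
  have eq: "(\<lambda>y. (y - x) /\<^sub>R \<epsilon>) ` E = (\<lambda>z. x + \<epsilon> *\<^sub>R z) -` E"
  proof (intro set_eqI iffI)
    fix z assume "z \<in> (\<lambda>z. x + \<epsilon> *\<^sub>R z) -` E"
    then show "z \<in> (\<lambda>y. (y - x) /\<^sub>R \<epsilon>) ` E"
      using \<open>\<epsilon> > 0\<close> by (intro image_eqI[of _ _ "x + \<epsilon> *\<^sub>R z"]) auto
  qed (use \<open>\<epsilon> > 0\<close> in auto)
  have "(\<lambda>z. x + \<epsilon> *\<^sub>R z) -` E \<inter> space (\<nu> x) \<in> sets (\<nu> x)"
    by (rule measurable_sets[where A = borel]) simp_all
  then have "(\<integral>\<^sup>+z. indicator ((\<lambda>z. x + \<epsilon> *\<^sub>R z) -` E) z \<partial>\<nu> x) = emeasure (\<nu> x) ((\<lambda>z. x + \<epsilon> *\<^sub>R z) -` E)"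
    by (intro nn_integral_indicator) (simp add: space)
  moreover have "(\<integral>\<^sup>+z. indicator ((\<lambda>z. x + \<epsilon> *\<^sub>R z) -` E) z \<partial>\<nu> x) = (\<integral>\<^sup>+z. indicator E (x + \<epsilon> *\<^sub>R z) \<partial>\<nu> x)"
    by (intro nn_integral_cong) (simp split: split_indicator)
  moreover have "(\<integral>\<^sup>+y. indicator (E \<inter> ball x \<epsilon>) y \<partial>lborel) = emeasure lborel (E \<inter> ball x \<epsilon>)"
    using E by (intro nn_integral_indicator) auto
  moreover have "(\<integral>\<^sup>+y. indicator (E \<inter> ball x \<epsilon>) y \<partial>lborel) = (\<integral>\<^sup>+y. indicator (ball x \<epsilon>) y * indicator E y \<partial>lborel)"
    by (intro nn_integral_cong) (simp split: split_indicator)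
  moreover have "emeasure lborel (E \<inter> ball x \<epsilon>) \<noteq> \<infinity>"
    using emeasure_mono[of "E \<inter> ball x \<epsilon>" "ball x \<epsilon>" lborel] emeasure_lborel_ball_finite[of x \<epsilon>]
    by (auto simp: top_unique)
  ultimately show ?thesis
    using assms
    by (simp add: chain_op_def transition_prob_def eq emeasure_eq_measure emeasure_eq_ennreal_measure
        flip: ennreal_mult ennreal_plus)
qed

lemma borel_measurable_indicator_ball_times:
  fixes u :: "'a::euclidean_space \<Rightarrow> ennreal"
  assumes "u \<in> borel_measurable borel"
  shows "(\<lambda>y. indicator (ball x r) y * u y) \<in> borel_measurable borel"
  using assms by (intro borel_measurable_times_ennreal borel_measurable_indicator) auto

text \<open>Homogeneity, additivity and continuity along increasing sequences carry the induction
  over measurable functions in \<open>chain_step\<close>.\<close>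

lemma chain_op_cmult:
  fixes \<nu> :: "real ^ 'n \<Rightarrow> (real ^ 'n) measure"
  assumes \<nu>: "admissible_family \<Lambda> \<nu>" and [measurable]: "u \<in> borel_measurable borel"
  shows "chain_op \<alpha> \<beta> \<epsilon> \<nu> (\<lambda>y. c * u y) x = c * chain_op \<alpha> \<beta> \<epsilon> \<nu> u x"
proof -
  note [measurable_cong] = admissible_family_sets(1)[OF \<nu>]
  show ?thesis
    using nn_integral_cmult[of "\<lambda>z. u (x + \<epsilon> *\<^sub>R z)" "\<nu> x" c]
      nn_integral_cmult[of "\<lambda>y. indicator (ball x \<epsilon>) y * u y" lborel c]
      borel_measurable_indicator_ball_times[of u x \<epsilon>]
    by (simp add: chain_op_def distrib_left mult.left_commute)
qed

lemma chain_op_add: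
  fixes \<nu> :: "real ^ 'n \<Rightarrow> (real ^ 'n) measure"
  assumes \<nu>: "admissible_family \<Lambda> \<nu>" and [measurable]: "u \<in> borel_measurable borel" "v \<in> borel_measurable borel"
  shows "chain_op \<alpha> \<beta> \<epsilon> \<nu> (\<lambda>y. u y + v y) x = chain_op \<alpha> \<beta> \<epsilon> \<nu> u x + chain_op \<alpha> \<beta> \<epsilon> \<nu> v x"
proof -
  note [measurable_cong] = admissible_family_sets(1)[OF \<nu>]
  show ?thesis
    using nn_integral_add[of "\<lambda>z. u (x + \<epsilon> *\<^sub>R z)" "\<nu> x" "\<lambda>z. v (x + \<epsilon> *\<^sub>R z)"]
      nn_integral_add[of "\<lambda>y. indicator (ball x \<epsilon>) y * u y" lborel "\<lambda>y. indicator (ball x \<epsilon>) y * v y"]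
      borel_measurable_indicator_ball_times[of u x \<epsilon>] borel_measurable_indicator_ball_times[of v x \<epsilon>]
    by (simp add: chain_op_def distrib_left add_ac)
qed

lemma chain_op_mono:
  assumes "\<And>y. u y \<le> v y"
  shows "chain_op \<alpha> \<beta> \<epsilon> \<nu> u x \<le> chain_op \<alpha> \<beta> \<epsilon> \<nu> v x"
  unfolding chain_op_def using assms by (intro add_mono mult_left_mono nn_integral_mono) auto

lemma chain_op_SUP:
  fixes \<nu> :: "real ^ 'n \<Rightarrow> (real ^ 'n) measure"
  assumes \<nu>: "admissible_family \<Lambda> \<nu>" and [measurable]: "\<And>i. U i \<in> borel_measurable borel" and "incseq U"
  shows "chain_op \<alpha> \<beta> \<epsilon> \<nu> (SUP i. U i) x = (SUP i. chain_op \<alpha> \<beta> \<epsilon> \<nu> (U i) x)"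
proof -
  note [measurable_cong] = admissible_family_sets(1)[OF \<nu>]
  have inc: "incseq (\<lambda>i z. U i (x + \<epsilon> *\<^sub>R z))" "incseq (\<lambda>i y. indicator (ball x \<epsilon>) y * U i y)"
    using \<open>incseq U\<close> by (auto simp: incseq_def le_fun_def intro!: mult_left_mono)
  have "(\<integral>\<^sup>+z. (SUP i. U i) (x + \<epsilon> *\<^sub>R z) \<partial>\<nu> x) = (SUP i. \<integral>\<^sup>+z. U i (x + \<epsilon> *\<^sub>R z) \<partial>\<nu> x)"
    unfolding SUP_apply by (rule nn_integral_monotone_convergence_SUP[OF inc(1)]) simp
  moreover have "(\<integral>\<^sup>+y. indicator (ball x \<epsilon>) y * (SUP i. U i) y \<partial>lborel) =
      (SUP i. \<integral>\<^sup>+y. indicator (ball x \<epsilon>) y * U i y \<partial>lborel)"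
    unfolding SUP_apply SUP_mult_left_ennreal
    by (rule nn_integral_monotone_convergence_SUP[OF inc(2)])
      (simp add: borel_measurable_indicator_ball_times)
  ultimately show ?thesis
    using inc \<open>incseq U\<close> unfolding chain_op_def
    by (simp add: SUP_mult_left_ennreal)
      (subst ennreal_SUP_add; auto simp: incseq_def le_fun_def intro!: mult_left_mono nn_integral_mono)
qed

text \<open>The event that the exit time exceeds \<open>k\<close> (see
  \<open>less_exit_time_iff\<close>), expressed through the coordinates up to \<open>k\<close>,
  which places it in \<open>past_algebra k\<close>.\<close>

definition survive :: "'a set \<Rightarrow> nat \<Rightarrow> (nat \<Rightarrow> 'a) set" where
  "survive \<Omega> k = {\<omega>. \<forall>i\<le>k. \<omega> i \<in> \<Omega>}"

lemma survive_Suc: "\<omega> \<in> survive \<Omega> (Suc k) \<longleftrightarrow> \<omega> \<in> survive \<Omega> k \<and> \<omega> (Suc k) \<in> \<Omega>"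
  by (auto simp: survive_def le_Suc_eq)

lemma less_exit_time_iff: "enat i < exit_time \<Omega> \<omega> \<longleftrightarrow> \<omega> \<in> survive \<Omega> i"
proof -
  have "enat i < exit_time \<Omega> \<omega> \<longleftrightarrow> (\<forall>n\<in>{n. \<omega> n \<notin> \<Omega>}. i < n)"
  proof
    assume "enat i < exit_time \<Omega> \<omega>"
    then show "\<forall>n\<in>{n. \<omega> n \<notin> \<Omega>}. i < n"
      unfolding exit_time_def by (metis Inf_lower enat_ord_simps(2) image_eqI less_le_trans)
  next
    assume *: "\<forall>n\<in>{n. \<omega> n \<notin> \<Omega>}. i < n"
    then have "enat (Suc i) \<le> exit_time \<Omega> \<omega>"
      unfolding exit_time_def by (intro Inf_greatest) (auto simp: Suc_le_eq)
    then show "enat i < exit_time \<Omega> \<omega>"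
      by (meson enat_ord_simps(2) less_le_trans lessI)
  qed
  also have "\<dots> \<longleftrightarrow> \<omega> \<in> survive \<Omega> i"
    unfolding survive_def by (auto simp flip: not_le)
  finally show ?thesis .
qed

text \<open>Counting the times before exit turns the expected exit time into a series of survival
  probabilities, also when the exit time is infinite.\<close>

lemma ennreal_of_enat_eq_suminf: "ennreal_of_enat n = (\<Sum>i. if enat i < n then 1 else 0)"
proof (cases n)
  case (enat k)
  have "(\<Sum>i. if enat i < n then 1 else 0 :: ennreal) = (\<Sum>i\<in>{..<k}. if enat i < n then 1 else 0)"
    by (rule suminf_finite) (auto simp: enat)
  also have "\<dots> = of_nat k"
    by (simp add: enat)
  finally show ?thesis
    by (simp add: enat)
next
  case infinity
  have "of_nat k \<le> (\<Sum>i. 1 :: ennreal)" for k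
    using sum_le_suminf[of "\<lambda>_. 1 :: ennreal" "{..<k}"] by simp
  then have "(\<Sum>i. 1 :: ennreal) = \<infinity>"
    by (metis ennreal_Ex_less_of_nat infinity_ennreal_def linorder_not_less top.not_eq_extremum)
  then show ?thesis
    by (simp add: infinity)
qed

section \<open>The past sigma-algebras and the Markov property\<close>

lemma sets_past_algebra:
  "sets (past_algebra k :: (nat \<Rightarrow> real ^ 'n) measure) =
    sigma_sets UNIV {(\<lambda>\<omega>. \<omega> i) -` A | i A. i \<le> k \<and> A \<in> sets borel}"
  by (simp add: past_algebra_def)

lemma past_algebra_vimage:
  fixes A :: "(real ^ 'n) set"
  shows "i \<le> k \<Longrightarrow> A \<in> sets borel \<Longrightarrow> (\<lambda>\<omega>. \<omega> i) -` A \<in> sets (past_algebra k)"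
  unfolding sets_past_algebra by (intro sigma_sets.Basic) blast

lemma survive_in_past_algebra:
  fixes \<Omega> :: "(real ^ 'n) set"
  assumes "\<Omega> \<in> sets borel"
  shows "survive \<Omega> k \<in> sets (past_algebra k)"
proof -
  have "survive \<Omega> k = (\<Inter>i\<in>{..k}. (\<lambda>\<omega>. \<omega> i) -` \<Omega>)"
    by (auto simp: survive_def)
  also have "\<dots> \<in> sets (past_algebra k)"
    using assms by (intro sets.finite_INT past_algebra_vimage) auto
  finally show ?thesis .
qed

lemma subalgebra_past_algebra:
  fixes P :: "(nat \<Rightarrow> real ^ 'n) measure"
  assumes P: "sets P = sets (\<Pi>\<^sub>M k\<in>UNIV. borel)"
  shows "subalgebra P (past_algebra k)"
proof -
  have space: "space P = UNIV"
    using sets_eq_imp_space_eq[OF P] by (simp add: space_PiM)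
  have "(\<lambda>\<omega>. \<omega> i) -` A \<in> sets P" if "A \<in> sets borel" for i and A :: "(real ^ 'n) set"
  proof -
    have "(\<lambda>\<omega>. \<omega> i) \<in> P \<rightarrow>\<^sub>M borel"
      using measurable_component_singleton[of i UNIV "\<lambda>_. borel"] by (simp cong: measurable_cong_sets add: P)
    from measurable_sets[OF this that] show ?thesis
      by (simp add: space)
  qed
  then have "{(\<lambda>\<omega>. \<omega> i) -` A | i A. i \<le> k \<and> A \<in> sets borel} \<subseteq> sets P"
    by blast
  then have "sets (past_algebra k) \<subseteq> sets P"
    unfolding sets_past_algebra space[symmetric] by (rule sets.sigma_sets_subset)
  then show ?thesis
    by (simp add: subalgebra_def space past_algebra_def)
qed

text \<open>Over an event \<open>A\<close> of the past, the conditional expectation has the same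
  integral as the indicator of the next step; almost everywhere it is the transition probability,
  which \<open>chain_op_indicator\<close> identifies with the operator.\<close>

lemma chain_step_indicator:
  fixes P :: "(nat \<Rightarrow> real ^ 'n) measure"
  assumes \<nu>: "admissible_family \<Lambda> \<nu>" and par: "\<alpha> \<ge> 0" "\<beta> \<ge> 0" "\<epsilon> > 0"
    and law: "chain_law \<alpha> \<beta> \<epsilon> \<nu> x P" and A: "A \<in> sets (past_algebra k)" and E[measurable]: "E \<in> sets borel"
  shows "(\<integral>\<^sup>+\<omega>. indicator A \<omega> * indicator E (\<omega> (Suc k)) \<partial>P) =
    (\<integral>\<^sup>+\<omega>. indicator A \<omega> * chain_op \<alpha> \<beta> \<epsilon> \<nu> (indicator E) (\<omega> k) \<partial>P)"
proof -
  interpret prob_space P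
    using law by (simp add: chain_law_def)
  have sets_P[measurable_cong]: "sets P = sets (\<Pi>\<^sub>M k\<in>UNIV. borel)"
    using law by (simp add: chain_law_def)
  have space: "space P = UNIV"
    using sets_eq_imp_space_eq[OF sets_P] by (simp add: space_PiM)
  interpret sigma_finite_subalgebra P "past_algebra k"
    by (intro finite_measure_subalgebra_is_sigma_finite finite_measure_subalgebra.intro
        finite_measure_subalgebra_axioms.intro subalgebra_past_algebra sets_P) unfold_locales
  have Am[measurable]: "A \<in> sets P"
    using A subalg by (auto simp: subalgebra_def)
  define S where "S = {\<omega> :: nat \<Rightarrow> real ^ 'n. \<omega> (Suc k) \<in> E}"
  define T where "T \<omega> = transition_prob \<alpha> \<beta> \<epsilon> \<nu> (\<omega> k) E" for \<omega>
  have "S = (\<lambda>\<omega>. \<omega> (Suc k)) -` E \<inter> space P"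
    by (auto simp: S_def space)
  then have Sm[measurable]: "S \<in> sets P"
    by simp
  \<comment> \<open>Measurability of the transition probability in its starting point is inherited
    from the operator applied to the indicator of \<open>E\<close>.\<close>
  have "(\<lambda>y. enn2real (chain_op \<alpha> \<beta> \<epsilon> \<nu> (indicator E) y)) \<in> borel_measurable borel"
    using measurable_chain_op[OF \<nu>, of "indicator E" \<alpha> \<beta> \<epsilon>] by simp
  then have "(\<lambda>y. transition_prob \<alpha> \<beta> \<epsilon> \<nu> y E) \<in> borel_measurable borel"
    by (simp add: chain_op_indicator[OF \<nu> par E] transition_prob_nonneg par)
  then have Tm[measurable]: "T \<in> borel_measurable P"
    unfolding T_def by measurable
  have T_nonneg: "T \<omega> \<ge> 0" for \<omega>
    using par by (simp add: T_def transition_prob_nonneg)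
  have int_S: "integrable P (indicator S :: _ \<Rightarrow> real)"
    by (intro integrable_real_indicator) (auto simp: less_top[symmetric])
  have AE_T: "AE \<omega> in P. real_cond_exp P (past_algebra k) (indicator S) \<omega> = T \<omega>"
    using law E unfolding chain_law_def S_def T_def by blast
  have int_T: "integrable P T"
    using real_cond_exp_int(1)[OF int_S] by (subst integrable_cong_AE[OF _ _ AE_T[THEN AE_symmetric]]) auto
  have "(\<integral>\<^sup>+\<omega>. indicator A \<omega> * indicator E (\<omega> (Suc k)) \<partial>P) = (\<integral>\<^sup>+\<omega>. ennreal (indicator A \<omega> * indicator S \<omega>) \<partial>P)"
    by (intro nn_integral_cong) (auto simp: S_def indicator_def)
  also have "\<dots> = ennreal (\<integral>\<omega>. indicator A \<omega> * indicator S \<omega> \<partial>P)"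
    using integrable_mult_indicator[OF Am int_S] by (intro nn_integral_eq_integral) auto
  also have "(\<integral>\<omega>. indicator A \<omega> * indicator S \<omega> \<partial>P) = (\<integral>\<omega>\<in>A. real_cond_exp P (past_algebra k) (indicator S) \<omega> \<partial>P)"
    using real_cond_exp_intA[OF int_S A] by (simp add: set_lebesgue_integral_def)
  also have "\<dots> = (\<integral>\<omega>. indicator A \<omega> * T \<omega> \<partial>P)"
    unfolding set_lebesgue_integral_def using AE_T by (intro integral_cong_AE) auto
  also have "ennreal \<dots> = (\<integral>\<^sup>+\<omega>. ennreal (indicator A \<omega> * T \<omega>) \<partial>P)"
    using integrable_mult_indicator[OF Am int_T] T_nonneg by (intro nn_integral_eq_integral[symmetric]) auto
  also have "\<dots> = (\<integral>\<^sup>+\<omega>. indicator A \<omega> * chain_op \<alpha> \<beta> \<epsilon> \<nu> (indicator E) (\<omega> k) \<partial>P)"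
    by (intro nn_integral_cong) (auto simp: chain_op_indicator[OF \<nu> par E] T_def indicator_def)
  finally show ?thesis .
qed

text \<open>Both sides are homogeneous, additive and monotonically continuous in \<open>u\<close>,
  so the identity spreads from indicators to all nonnegative measurable functions.\<close>

lemma chain_step:
  fixes P :: "(nat \<Rightarrow> real ^ 'n) measure"
  assumes \<nu>: "admissible_family \<Lambda> \<nu>" and par: "\<alpha> \<ge> 0" "\<beta> \<ge> 0" "\<epsilon> > 0"
    and law: "chain_law \<alpha> \<beta> \<epsilon> \<nu> x P" and A: "A \<in> sets (past_algebra k)" and u: "u \<in> borel_measurable borel"
  shows "(\<integral>\<^sup>+\<omega>. indicator A \<omega> * u (\<omega> (Suc k)) \<partial>P) =
    (\<integral>\<^sup>+\<omega>. indicator A \<omega> * chain_op \<alpha> \<beta> \<epsilon> \<nu> u (\<omega> k) \<partial>P)"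
proof -
  have sets_P[measurable_cong]: "sets P = sets (\<Pi>\<^sub>M k\<in>UNIV. borel)"
    using law by (simp add: chain_law_def)
  have [measurable]: "A \<in> sets P"
    using A subalgebra_past_algebra[OF sets_P] by (auto simp: subalgebra_def)
  show ?thesis
    using u
  proof (induction rule: borel_measurable_induct)
    case (cong f g)
    then have "f = g"
      by auto
    with cong show ?case
      by simp
  next
    case (set E)
    then show ?case
      using chain_step_indicator[OF \<nu> par law A] by simp
  next
    case (mult u c)
    note [measurable] = mult(2) measurable_chain_op[OF \<nu> mult(2)]
    show ?case
      using mult by (simp add: chain_op_cmult[OF \<nu>] mult.left_commute[of _ c] nn_integral_cmult)
  next
    case (add u v)
    note [measurable] = \<open>u \<in> borel_measurable borel\<close> \<open>v \<in> borel_measurable borel\<close>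
    note [measurable] = this[THEN measurable_chain_op[OF \<nu>]]
    show ?case
      using add by (simp add: chain_op_add[OF \<nu>] distrib_left nn_integral_add)
  next
    case (seq U)
    note [measurable] = seq(1) measurable_chain_op[OF \<nu> seq(1)]
    have "(\<integral>\<^sup>+\<omega>. indicator A \<omega> * (SUP i. U i) (\<omega> (Suc k)) \<partial>P) = (SUP i. \<integral>\<^sup>+\<omega>. indicator A \<omega> * U i (\<omega> (Suc k)) \<partial>P)"
      unfolding SUP_apply SUP_mult_left_ennreal using \<open>incseq U\<close>
      by (intro nn_integral_monotone_convergence_SUP) (auto simp: incseq_def le_fun_def intro!: mult_left_mono)
    also have "\<dots> = (SUP i. \<integral>\<^sup>+\<omega>. indicator A \<omega> * chain_op \<alpha> \<beta> \<epsilon> \<nu> (U i) (\<omega> k) \<partial>P)"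
      using seq by simp
    also have "\<dots> = (\<integral>\<^sup>+\<omega>. indicator A \<omega> * chain_op \<alpha> \<beta> \<epsilon> \<nu> (SUP i. U i) (\<omega> k) \<partial>P)"
      unfolding chain_op_SUP[OF \<nu> seq(1) \<open>incseq U\<close>] SUP_mult_left_ennreal using \<open>incseq U\<close>
      by (intro nn_integral_monotone_convergence_SUP[symmetric])
        (auto simp: incseq_def le_fun_def intro!: mult_left_mono chain_op_mono)
    finally show ?case .
  qed
qed

text \<open>Value iteration: for the one-step operator of the chain, the \<open>n\<close>-th iterate
  is the expected reward \<open>h\<close> collected at the first \<open>n\<close> times before
  leaving \<open>\<Omega>\<close>. These iterates are the functions \<open>w\<close> fed to
  \<open>abp_estimate\<close>.\<close>

fun finite_horizon :: "(('a \<Rightarrow> ennreal) \<Rightarrow> 'a \<Rightarrow> ennreal) \<Rightarrow> 'a set \<Rightarrow> ('a \<Rightarrow> ennreal) \<Rightarrow> nat \<Rightarrow> 'a \<Rightarrow> ennreal" where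
  "finite_horizon L \<Omega> h 0 = (\<lambda>_. 0)"
| "finite_horizon L \<Omega> h (Suc n) = (\<lambda>y. if y \<in> \<Omega> then L (finite_horizon L \<Omega> h n) y + h y else 0)"

lemma finite_horizon_outside: "y \<notin> \<Omega> \<Longrightarrow> finite_horizon L \<Omega> h n y = 0"
  by (cases n) auto

text \<open>Growth with the horizon turns the recursion, an equation between consecutive iterates,
  into the inequality for a single \<open>w\<close> that \<open>abp_estimate\<close>
  assumes.\<close>

lemma finite_horizon_mono:
  assumes "\<And>u v y. (\<And>z. u z \<le> v z) \<Longrightarrow> L u y \<le> L v y"
  shows "finite_horizon L \<Omega> h n y \<le> finite_horizon L \<Omega> h (Suc n) y"
proof (induction n arbitrary: y)
  case (Suc n)
  have "L (finite_horizon L \<Omega> h n) y \<le> L (finite_horizon L \<Omega> h (Suc n)) y"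
    by (intro assms Suc)
  then show ?case
    by (auto intro: add_right_mono)
qed simp

lemma measurable_finite_horizon:
  fixes \<Omega> :: "(real ^ 'n) set"
  assumes "admissible_family \<Lambda> \<nu>" and [measurable]: "\<Omega> \<in> sets borel" "h \<in> borel_measurable borel"
  shows "finite_horizon (chain_op \<alpha> \<beta> \<epsilon> \<nu>) \<Omega> h n \<in> borel_measurable borel"
proof (induction n)
  case (Suc n)
  note [measurable] = measurable_chain_op[OF assms(1) Suc, of \<alpha> \<beta> \<epsilon>]
  show ?case
    by simp
qed simp

text \<open>Induction on the horizon with the starting time \<open>k\<close> arbitrary: the reward
  at time \<open>k\<close> is split off, and \<open>chain_step\<close> replaces the value at time
  \<open>Suc k\<close> by one application of the operator at time \<open>k\<close>.\<close>

lemma finite_horizon_ge_sum: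
  fixes P :: "(nat \<Rightarrow> real ^ 'n) measure"
  assumes \<nu>: "admissible_family \<Lambda> \<nu>" and par: "\<alpha> \<ge> 0" "\<beta> \<ge> 0" "\<epsilon> > 0"
    and law: "chain_law \<alpha> \<beta> \<epsilon> \<nu> x P" and \<Omega>: "\<Omega> \<in> sets borel" and h[measurable]: "h \<in> borel_measurable borel"
  shows "(\<Sum>i<n. \<integral>\<^sup>+\<omega>. indicator (survive \<Omega> (k + i)) \<omega> * h (\<omega> (k + i)) \<partial>P) \<le>
    (\<integral>\<^sup>+\<omega>. indicator (survive \<Omega> k) \<omega> * finite_horizon (chain_op \<alpha> \<beta> \<epsilon> \<nu>) \<Omega> h n (\<omega> k) \<partial>P)"
proof (induction n arbitrary: k)
  case (Suc n)
  let ?L = "chain_op \<alpha> \<beta> \<epsilon> \<nu>"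
  let ?H = "finite_horizon ?L \<Omega> h n"
  have sets_P[measurable_cong]: "sets P = sets (\<Pi>\<^sub>M k\<in>UNIV. borel)"
    using law by (simp add: chain_law_def)
  have [measurable]: "survive \<Omega> k \<in> sets P"
    using survive_in_past_algebra[OF \<Omega>] subalgebra_past_algebra[OF sets_P] by (auto simp: subalgebra_def)
  note H[measurable] = measurable_finite_horizon[OF \<nu> \<Omega> h, of \<alpha> \<beta> \<epsilon> n]
  note [measurable] = measurable_chain_op[OF \<nu> H, of \<alpha> \<beta> \<epsilon>]
  have "(\<Sum>i<Suc n. \<integral>\<^sup>+\<omega>. indicator (survive \<Omega> (k + i)) \<omega> * h (\<omega> (k + i)) \<partial>P) =
      (\<integral>\<^sup>+\<omega>. indicator (survive \<Omega> k) \<omega> * h (\<omega> k) \<partial>P) +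
      (\<Sum>i<n. \<integral>\<^sup>+\<omega>. indicator (survive \<Omega> (Suc k + i)) \<omega> * h (\<omega> (Suc k + i)) \<partial>P)"
    by (simp add: sum.lessThan_Suc_shift del: sum.lessThan_Suc)
  also have "\<dots> \<le> (\<integral>\<^sup>+\<omega>. indicator (survive \<Omega> k) \<omega> * h (\<omega> k) \<partial>P) +
      (\<integral>\<^sup>+\<omega>. indicator (survive \<Omega> (Suc k)) \<omega> * ?H (\<omega> (Suc k)) \<partial>P)"
    by (intro add_left_mono Suc)
  \<comment> \<open>\<open>chain_step\<close> asks for an event of \<open>past_algebra k\<close>, so
    the condition that step \<open>Suc k\<close> stays in \<open>\<Omega>\<close> is dropped.
    Nothing is lost, as \<open>?H\<close> vanishes outside \<open>\<Omega>\<close>.\<close>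
  also have "\<dots> \<le> (\<integral>\<^sup>+\<omega>. indicator (survive \<Omega> k) \<omega> * h (\<omega> k) \<partial>P) +
      (\<integral>\<^sup>+\<omega>. indicator (survive \<Omega> k) \<omega> * ?H (\<omega> (Suc k)) \<partial>P)"
    by (intro add_left_mono nn_integral_mono mult_right_mono) (auto simp: survive_Suc indicator_def)
  also have "\<dots> = (\<integral>\<^sup>+\<omega>. indicator (survive \<Omega> k) \<omega> * h (\<omega> k) \<partial>P) +
      (\<integral>\<^sup>+\<omega>. indicator (survive \<Omega> k) \<omega> * ?L ?H (\<omega> k) \<partial>P)"
    by (simp only: chain_step[OF \<nu> par law survive_in_past_algebra[OF \<Omega>] H])
  also have "\<dots> = (\<integral>\<^sup>+\<omega>. indicator (survive \<Omega> k) \<omega> * h (\<omega> k) + indicator (survive \<Omega> k) \<omega> * ?L ?H (\<omega> k) \<partial>P)"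
    by (intro nn_integral_add[symmetric]) simp_all
  also have "\<dots> = (\<integral>\<^sup>+\<omega>. indicator (survive \<Omega> k) \<omega> * finite_horizon ?L \<Omega> h (Suc n) (\<omega> k) \<partial>P)"
    by (intro nn_integral_cong) (auto simp: indicator_def survive_def add.commute)
  finally show ?case .
qed simp

section \<open>The reward bound\<close>

lemma chain_op_real:
  fixes \<nu> :: "real ^ 'n \<Rightarrow> (real ^ 'n) measure" and w :: "real ^ 'n \<Rightarrow> real"
  assumes \<nu>: "admissible_family \<Lambda> \<nu>" and "\<alpha> \<ge> 0" "\<beta> \<ge> 0"
    and [measurable]: "w \<in> borel_measurable borel" and w: "\<And>y. 0 \<le> w y" "\<And>y. w y \<le> W"
  shows "chain_op \<alpha> \<beta> \<epsilon> \<nu> (\<lambda>y. ennreal (w y)) x = ennreal (\<alpha> * (\<integral>z. w (x + \<epsilon> *\<^sub>R z) \<partial>\<nu> x) +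
    \<beta> / measure lborel (ball (0 :: real ^ 'n) \<epsilon>) * (\<integral>y. indicator (ball x \<epsilon>) y * w y \<partial>lborel))"
proof -
  note [measurable_cong] = admissible_family_sets(1)[OF \<nu>]
  interpret prob_space "\<nu> x"
    by (rule admissible_family_sets[OF \<nu>])
  have "(\<integral>\<^sup>+z. ennreal (w (x + \<epsilon> *\<^sub>R z)) \<partial>\<nu> x) = ennreal (\<integral>z. w (x + \<epsilon> *\<^sub>R z) \<partial>\<nu> x)"
    using w by (intro nn_integral_eq_integral integrable_const_bound[where B = W]) auto
  moreover have "(\<integral>\<^sup>+y. indicator (ball x \<epsilon>) y * ennreal (w y) \<partial>lborel) =
      (\<integral>\<^sup>+y. ennreal (indicator (ball x \<epsilon>) y * w y) \<partial>lborel)"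
    by (intro nn_integral_cong) (simp split: split_indicator)
  moreover have "\<dots> = ennreal (\<integral>y. indicator (ball x \<epsilon>) y * w y \<partial>lborel)"
    using w by (intro nn_integral_eq_integral integrable_indicator_ball_bounded[where B = W])
      (auto simp: abs_le_iff intro: order_trans[of _ 0])
  moreover have "(\<integral>z. w (x + \<epsilon> *\<^sub>R z) \<partial>\<nu> x) \<ge> 0" "(\<integral>y. indicator (ball x \<epsilon>) y * w y \<partial>lborel) \<ge> 0"
    using w by (auto intro!: integral_nonneg)
  ultimately show ?thesis
    using \<open>\<alpha> \<ge> 0\<close> \<open>\<beta> \<ge> 0\<close>
    by (simp add: chain_op_def ennreal_mult[symmetric] ennreal_plus[symmetric] del: ennreal_plus)
qed

lemma chain_op_le_const:
  fixes \<nu> :: "real ^ 'n \<Rightarrow> (real ^ 'n) measure"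
  assumes \<nu>: "admissible_family \<Lambda> \<nu>" and "\<alpha> \<ge> 0" "\<beta> \<ge> 0" "\<epsilon> > 0" and u: "\<And>y. u y \<le> c"
  shows "chain_op \<alpha> \<beta> \<epsilon> \<nu> u x \<le> ennreal (\<alpha> + \<beta>) * c"
proof -
  interpret prob_space "\<nu> x"
    by (rule admissible_family_sets[OF \<nu>])
  have m: "measure lborel (ball (0 :: real ^ 'n) \<epsilon>) > 0" "emeasure lborel (ball x \<epsilon>) = ennreal (measure lborel (ball (0 :: real ^ 'n) \<epsilon>))"
    using \<open>\<epsilon> > 0\<close> by (simp_all add: emeasure_ball content_ball)
  have "chain_op \<alpha> \<beta> \<epsilon> \<nu> u x \<le> chain_op \<alpha> \<beta> \<epsilon> \<nu> (\<lambda>_. c) x"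
    by (intro chain_op_mono u)
  also have "\<dots> = ennreal \<alpha> * c + ennreal (\<beta> / measure lborel (ball (0 :: real ^ 'n) \<epsilon>)) *
      (c * ennreal (measure lborel (ball (0 :: real ^ 'n) \<epsilon>)))"
    by (simp add: chain_op_def emeasure_space_1 mult.commute[of "indicator _ _"] nn_integral_cmult_indicator m)
  also have "\<dots> = ennreal \<alpha> * c + (ennreal (\<beta> / measure lborel (ball (0 :: real ^ 'n) \<epsilon>)) *
      ennreal (measure lborel (ball (0 :: real ^ 'n) \<epsilon>))) * c"
    by (simp only: mult_ac)
  also have "ennreal (\<beta> / measure lborel (ball (0 :: real ^ 'n) \<epsilon>)) *
      ennreal (measure lborel (ball (0 :: real ^ 'n) \<epsilon>)) = ennreal \<beta>"
    using assms(3) m(1) by (simp flip: ennreal_mult)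
  also have "ennreal \<alpha> * c + ennreal \<beta> * c = ennreal (\<alpha> + \<beta>) * c"
    using assms(2,3) by (simp add: distrib_right)
  finally show ?thesis .
qed

text \<open>One step preserves constants, so each iteration adds at most \<open>c\<close>. The bound
  grows with \<open>n\<close> and serves only to make every iterate a bounded real function.\<close>

lemma finite_horizon_le:
  fixes \<nu> :: "real ^ 'n \<Rightarrow> (real ^ 'n) measure"
  assumes \<nu>: "admissible_family \<Lambda> \<nu>" and par: "\<alpha> \<ge> 0" "\<beta> \<ge> 0" "\<epsilon> > 0" "\<alpha> + \<beta> = 1" and h: "\<And>y. h y \<le> c"
  shows "finite_horizon (chain_op \<alpha> \<beta> \<epsilon> \<nu>) \<Omega> h n y \<le> of_nat n * c"
proof (induction n arbitrary: y)
  case (Suc n)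
  have "chain_op \<alpha> \<beta> \<epsilon> \<nu> (finite_horizon (chain_op \<alpha> \<beta> \<epsilon> \<nu>) \<Omega> h n) y \<le> ennreal (\<alpha> + \<beta>) * (of_nat n * c)"
    using Suc by (intro chain_op_le_const[OF \<nu> par(1-3)])
  then have "chain_op \<alpha> \<beta> \<epsilon> \<nu> (finite_horizon (chain_op \<alpha> \<beta> \<epsilon> \<nu>) \<Omega> h n) y + h y \<le> of_nat n * c + c"
    using h[of y] par by (intro add_mono) auto
  then show ?case
    by (simp add: distrib_right add.commute)
qed simp

text \<open>The reward \<open>h\<close> is \<open>\<epsilon>\<^sup>2 * \<beta>\<close> times the
  average of \<open>f\<close> over the \<open>\<epsilon>\<close>-ball, which is the source term in
  \<open>abp_estimate\<close>. The resulting bound is free of both \<open>n\<close> and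
  \<open>B\<close>.\<close>

lemma finite_horizon_le_abp:
  fixes \<nu> :: "real ^ 'n \<Rightarrow> (real ^ 'n) measure" and f :: "real ^ 'n \<Rightarrow> real"
  defines "N \<equiv> CARD('n)"
  assumes \<nu>: "admissible_family \<Lambda> \<nu>"
    and par: "\<Lambda> \<ge> 1" "\<epsilon> > 0" "\<alpha> \<ge> 0" "\<beta> > 0" "\<alpha> + \<beta> = 1"
    and \<Omega>: "bounded \<Omega>" "x0 \<in> \<Omega>" "\<Omega> \<in> sets borel"
    and fm[measurable]: "f \<in> borel_measurable borel" and f: "\<And>y. 0 \<le> f y" "\<And>y. f y \<le> B"
      "integrable lborel f" "integrable lborel (\<lambda>y. f y ^ N)"
  defines "h \<equiv> \<lambda>y. ennreal (\<epsilon>\<^sup>2) * chain_op 0 \<beta> \<epsilon> \<nu> (\<lambda>y. ennreal (f y)) y"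
  shows "finite_horizon (chain_op \<alpha> \<beta> \<epsilon> \<nu>) \<Omega> h n x0 \<le>
    ennreal (abp_constant N powr (1 / N) * (diameter \<Omega> + \<Lambda> * \<epsilon>) * (\<integral>y. f y ^ N \<partial>lborel) powr (1 / N))"
proof -
  let ?H = "finite_horizon (chain_op \<alpha> \<beta> \<epsilon> \<nu>) \<Omega> h"
  let ?m = "measure lborel (ball (0 :: real ^ 'n) \<epsilon>)"
  define c where "c = \<epsilon>\<^sup>2 * (\<beta> * B)"
  define w where "w y = enn2real (?H n y)" for y
  have "B \<ge> 0"
    using f(1,2) order_trans by blast
  have hm: "h \<in> borel_measurable borel"
    using measurable_chain_op[OF \<nu>, of "\<lambda>y. ennreal (f y)" 0 \<beta> \<epsilon>] unfolding h_def by measurable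
  have "h y \<le> ennreal c" for y
  proof -
    have "chain_op 0 \<beta> \<epsilon> \<nu> (\<lambda>y. ennreal (f y)) y \<le> ennreal (0 + \<beta>) * ennreal B"
      using par f by (intro chain_op_le_const[OF \<nu>]) (auto intro: ennreal_leI)
    then have "h y \<le> ennreal (\<epsilon>\<^sup>2) * (ennreal \<beta> * ennreal B)"
      unfolding h_def by (intro mult_left_mono) auto
    also have "\<dots> = ennreal c"
      using par \<open>B \<ge> 0\<close> by (simp add: c_def ennreal_mult)
    finally show ?thesis .
  qed
  then have "?H n y \<le> of_nat n * ennreal c" for y
    using par by (intro finite_horizon_le[OF \<nu>]) auto
  moreover have "of_nat n * ennreal c = ennreal (real n * c)"
    using par \<open>B \<ge> 0\<close> by (simp add: c_def ennreal_mult ennreal_of_nat_eq_real_of_nat)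
  ultimately have H_le: "?H n y \<le> ennreal (real n * c)" for y
    by simp
  then have H: "?H n y = ennreal (w y)" for y
    unfolding w_def by (metis ennreal_enn2real ennreal_less_top le_less_trans)
  have wm: "w \<in> borel_measurable borel"
    using measurable_finite_horizon[OF \<nu> \<Omega>(3) hm, of \<alpha> \<beta> \<epsilon> n] unfolding w_def by measurable
  have w: "0 \<le> w y" "w y \<le> real n * c" "y \<notin> \<Omega> \<Longrightarrow> w y = 0" for y
    using H_le[of y] par \<open>B \<ge> 0\<close>
    by (auto simp: w_def c_def finite_horizon_outside intro!: enn2real_leI)
  have sub: "w x \<le> \<alpha> * (\<integral>z. w (x + \<epsilon> *\<^sub>R z) \<partial>\<nu> x) + \<beta> / ?m * ((\<integral>y. indicator (ball x \<epsilon>) y * w y \<partial>lborel) +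
        \<epsilon>\<^sup>2 * (\<integral>y. indicator (ball x \<epsilon>) y * f y \<partial>lborel))" if "x \<in> \<Omega>" for x
  proof -
    let ?I = "\<integral>z. w (x + \<epsilon> *\<^sub>R z) \<partial>\<nu> x"
    let ?J = "\<lambda>g :: real ^ 'n \<Rightarrow> real. \<integral>y. indicator (ball x \<epsilon>) y * g y \<partial>lborel"
    have nonneg: "?I \<ge> 0" "?J w \<ge> 0" "?J f \<ge> 0"
      using w f by (auto intro!: integral_nonneg)
    have "ennreal (w x) \<le> ?H (Suc n) x"
      unfolding H[symmetric] by (intro finite_horizon_mono chain_op_mono)
    also have "\<dots> = chain_op \<alpha> \<beta> \<epsilon> \<nu> (\<lambda>y. ennreal (w y)) x + h x"
      using that by (simp flip: H)
    also have "\<dots> = ennreal (\<alpha> * ?I + \<beta> / ?m * ?J w) + ennreal (\<epsilon>\<^sup>2) * ennreal (\<beta> / ?m * ?J f)"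
      using chain_op_real[OF \<nu> _ _ wm w(1,2), of \<alpha> \<beta> \<epsilon> x] chain_op_real[OF \<nu> _ _ fm f(1,2), of 0 \<beta> \<epsilon> x] par
      by (simp add: h_def)
    also have "\<dots> = ennreal (\<alpha> * ?I + \<beta> / ?m * ?J w + \<epsilon>\<^sup>2 * (\<beta> / ?m * ?J f))"
      using nonneg par by (subst ennreal_mult[symmetric]; (subst ennreal_plus[symmetric])?) auto
    finally have "w x \<le> \<alpha> * ?I + \<beta> / ?m * ?J w + \<epsilon>\<^sup>2 * (\<beta> / ?m * ?J f)"
      using nonneg par by (subst (asm) ennreal_le_iff) auto
    then show ?thesis
      by (simp add: distrib_left mult_ac)
  qed
  have "w x0 \<le> abp_constant N powr (1 / N) * (diameter \<Omega> + \<Lambda> * \<epsilon>) * (\<integral>y. f y ^ N \<partial>lborel) powr (1 / N)"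
    unfolding N_def
  proof (rule abp_estimate[OF _ par \<Omega>(1,2) wm w])
    show "\<nu> x \<in> sym_prob_measures \<Lambda>" for x
      using \<nu> by (simp add: admissible_family_def)
  qed (use f sub in \<open>auto simp: N_def\<close>)
  then show ?thesis
    unfolding H by (rule ennreal_leI)
qed

text \<open>The finite-horizon bound is uniform in the horizon and therefore passes from partial
  sums to the series.\<close>

lemma occupation_le:
  fixes P :: "(nat \<Rightarrow> real ^ 'n) measure" and f :: "real ^ 'n \<Rightarrow> real"
  defines "N \<equiv> CARD('n)"
  assumes \<nu>: "admissible_family \<Lambda> \<nu>"
    and par: "\<Lambda> \<ge> 1" "\<epsilon> > 0" "\<alpha> \<ge> 0" "\<beta> > 0" "\<alpha> + \<beta> = 1"
    and \<Omega>: "bounded \<Omega>" "x \<in> \<Omega>" "\<Omega> \<in> sets borel"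
    and law: "chain_law \<alpha> \<beta> \<epsilon> \<nu> x P"
    and fm[measurable]: "f \<in> borel_measurable borel" and f: "\<And>y. 0 \<le> f y" "\<And>y. f y \<le> B"
      "integrable lborel f" "integrable lborel (\<lambda>y. f y ^ N)"
  shows "(\<Sum>i. \<integral>\<^sup>+\<omega>. indicator (survive \<Omega> i) \<omega> * (ennreal (\<epsilon>\<^sup>2) * chain_op 0 \<beta> \<epsilon> \<nu> (\<lambda>y. ennreal (f y)) (\<omega> i)) \<partial>P) \<le>
    ennreal (abp_constant N powr (1 / N) * (diameter \<Omega> + \<Lambda> * \<epsilon>) * (\<integral>y. f y ^ N \<partial>lborel) powr (1 / N))"
proof (rule suminf_le_const)
  fix n
  define h where "h = (\<lambda>y. ennreal (\<epsilon>\<^sup>2) * chain_op 0 \<beta> \<epsilon> \<nu> (\<lambda>y. ennreal (f y)) y)"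
  let ?H = "finite_horizon (chain_op \<alpha> \<beta> \<epsilon> \<nu>) \<Omega> h n"
  interpret prob_space P
    using law by (simp add: chain_law_def)
  have hm: "h \<in> borel_measurable borel"
    using measurable_chain_op[OF \<nu>, of "\<lambda>y. ennreal (f y)" 0 \<beta> \<epsilon>] unfolding h_def by measurable
  have "AE \<omega> in P. \<omega> 0 = x"
    using law by (simp add: chain_law_def)
  \<comment> \<open>The chain starts at \<open>x\<close> almost surely, so the integral at time 0
    collapses to the value of \<open>?H\<close> at \<open>x\<close>.\<close>
  then have "(\<integral>\<^sup>+\<omega>. indicator (survive \<Omega> 0) \<omega> * ?H (\<omega> 0) \<partial>P) \<le> (\<integral>\<^sup>+\<omega>. ?H x \<partial>P)"
    by (intro nn_integral_mono_AE) (auto simp: indicator_def elim!: eventually_mono)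
  also have "\<dots> = ?H x"
    by (simp add: emeasure_space_1)
  finally have "(\<Sum>i<n. \<integral>\<^sup>+\<omega>. indicator (survive \<Omega> (0 + i)) \<omega> * h (\<omega> (0 + i)) \<partial>P) \<le> ?H x"
    using finite_horizon_ge_sum[OF \<nu> _ _ _ law \<Omega>(3) hm, of 0 n] par by (meson less_imp_le order_trans)
  also have "\<dots> \<le> ennreal (abp_constant N powr (1 / N) * (diameter \<Omega> + \<Lambda> * \<epsilon>) * (\<integral>y. f y ^ N \<partial>lborel) powr (1 / N))"
    unfolding h_def N_def by (rule finite_horizon_le_abp[OF \<nu> par \<Omega> fm f(1,2,3) f(4)[unfolded N_def]])
  finally show "(\<Sum>i<n. \<integral>\<^sup>+\<omega>. indicator (survive \<Omega> i) \<omega> * (ennreal (\<epsilon>\<^sup>2) * chain_op 0 \<beta> \<epsilon> \<nu> (\<lambda>y. ennreal (f y)) (\<omega> i)) \<partial>P) \<le>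
    ennreal (abp_constant N powr (1 / N) * (diameter \<Omega> + \<Lambda> * \<epsilon>) * (\<integral>y. f y ^ N \<partial>lborel) powr (1 / N))"
    by (simp add: h_def)
qed (rule summableI)

lemma chain_op_split:
  "chain_op \<alpha> \<beta> \<epsilon> \<nu> u x = chain_op \<alpha> 0 \<epsilon> \<nu> u x + chain_op 0 \<beta> \<epsilon> \<nu> u x"
  by (simp add: chain_op_def)

text \<open>The reward at time 0 is at most \<open>B\<close>. Every later reward is averaged over
  the step leading to it: the \<open>\<nu>\<close>-part contributes at most
  \<open>\<alpha> * B\<close> per step taken before exit, and the ball parts sum up to the quantity
  in \<open>occupation_le\<close>.\<close>

lemma expected_reward_le:
  fixes P :: "(nat \<Rightarrow> real ^ 'n) measure" and f :: "real ^ 'n \<Rightarrow> real"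
  defines "N \<equiv> CARD('n)"
  assumes \<nu>: "admissible_family \<Lambda> \<nu>"
    and par: "\<Lambda> \<ge> 1" "\<epsilon> > 0" "\<alpha> \<ge> 0" "\<beta> > 0" "\<alpha> + \<beta> = 1"
    and \<Omega>: "bounded \<Omega>" "x \<in> \<Omega>" "\<Omega> \<in> sets borel"
    and law: "chain_law \<alpha> \<beta> \<epsilon> \<nu> x P"
    and fm[measurable]: "f \<in> borel_measurable borel" and f: "\<And>y. 0 \<le> f y" "\<And>y. f y \<le> B"
      "integrable lborel f" "integrable lborel (\<lambda>y. f y ^ N)"
  shows "(\<integral>\<^sup>+\<omega>. ennreal (\<epsilon>\<^sup>2) * (\<Sum>i. indicator (survive \<Omega> i) \<omega> * ennreal (f (\<omega> i))) \<partial>P) \<le>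
    (ennreal (\<epsilon>\<^sup>2) + ennreal \<alpha> * (\<integral>\<^sup>+\<omega>. ennreal (\<epsilon>\<^sup>2) * ennreal_of_enat (exit_time \<Omega> \<omega>) \<partial>P)) * ennreal B +
    ennreal (abp_constant N powr (1 / N) * (diameter \<Omega> + \<Lambda> * \<epsilon>) * (\<integral>y. f y ^ N \<partial>lborel) powr (1 / N))"
proof -
  interpret prob_space P
    using law by (simp add: chain_law_def)
  have sets_P[measurable_cong]: "sets P = sets (\<Pi>\<^sub>M k\<in>UNIV. borel)"
    using law by (simp add: chain_law_def)
  have surv[measurable]: "survive \<Omega> k \<in> sets P" for k
    using survive_in_past_algebra[OF \<Omega>(3)] subalgebra_past_algebra[OF sets_P] by (auto simp: subalgebra_def)
  let ?F = "\<lambda>y. ennreal (f y)"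
  let ?G = "chain_op 0 \<beta> \<epsilon> \<nu> ?F"
  have Fm: "?F \<in> borel_measurable borel"
    by measurable
  note [measurable] = measurable_chain_op[OF \<nu> Fm, of 0 \<beta> \<epsilon>]
  define a q c where "a i = (\<integral>\<^sup>+\<omega>. indicator (survive \<Omega> i) \<omega> * ?F (\<omega> i) \<partial>P)"
    and "q i = (\<integral>\<^sup>+\<omega>. indicator (survive \<Omega> i) \<omega> \<partial>P)"
    and "c i = (\<integral>\<^sup>+\<omega>. indicator (survive \<Omega> i) \<omega> * ?G (\<omega> i) \<partial>P)" for i
  have "a 0 \<le> (\<integral>\<^sup>+\<omega>. ennreal B \<partial>P)"
    unfolding a_def using f by (intro nn_integral_mono) (auto simp: indicator_def intro: ennreal_leI)
  then have a_0: "a 0 \<le> ennreal B"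
    by (simp add: emeasure_space_1)
  have a_Suc: "a (Suc i) \<le> ennreal \<alpha> * ennreal B * q i + c i" for i
  proof -
    have "a (Suc i) \<le> (\<integral>\<^sup>+\<omega>. indicator (survive \<Omega> i) \<omega> * ?F (\<omega> (Suc i)) \<partial>P)"
      unfolding a_def by (intro nn_integral_mono mult_right_mono) (auto simp: survive_Suc indicator_def)
    also have "\<dots> = (\<integral>\<^sup>+\<omega>. indicator (survive \<Omega> i) \<omega> * chain_op \<alpha> \<beta> \<epsilon> \<nu> ?F (\<omega> i) \<partial>P)"
      using par by (intro chain_step[OF \<nu> _ _ _ law survive_in_past_algebra[OF \<Omega>(3)] Fm]) auto
    also have "\<dots> \<le> (\<integral>\<^sup>+\<omega>. indicator (survive \<Omega> i) \<omega> * (ennreal \<alpha> * ennreal B + ?G (\<omega> i)) \<partial>P)"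
    proof (intro nn_integral_mono mult_left_mono)
      fix \<omega>
      have "chain_op \<alpha> 0 \<epsilon> \<nu> ?F (\<omega> i) \<le> ennreal (\<alpha> + 0) * ennreal B"
        using par f by (intro chain_op_le_const[OF \<nu>]) (auto intro: ennreal_leI)
      then show "chain_op \<alpha> \<beta> \<epsilon> \<nu> ?F (\<omega> i) \<le> ennreal \<alpha> * ennreal B + ?G (\<omega> i)"
        by (subst chain_op_split) (auto intro: add_right_mono)
    qed simp
    also have "\<dots> = (\<integral>\<^sup>+\<omega>. ennreal \<alpha> * ennreal B * indicator (survive \<Omega> i) \<omega> + indicator (survive \<Omega> i) \<omega> * ?G (\<omega> i) \<partial>P)"
      by (intro nn_integral_cong) (simp add: distrib_left mult_ac)
    also have "\<dots> = ennreal \<alpha> * ennreal B * q i + c i"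
      unfolding q_def c_def by (subst nn_integral_add) (auto simp: nn_integral_cmult)
    finally show ?thesis .
  qed
  \<comment> \<open>The shift pairs the reward at time \<open>Suc i\<close> with survival up to time
    \<open>i\<close>. The sum of all \<open>q i\<close> is the full expected exit time, and the
    unpaired term \<open>a 0\<close> produces the isolated \<open>B\<close>, hence the summand
    \<open>\<epsilon>\<^sup>2\<close> in the final bound.\<close>
  have "suminf a = (\<Sum>i. a (Suc i)) + a 0"
    using suminf_offset[of a 1] by simp
  also have "\<dots> \<le> (\<Sum>i. ennreal \<alpha> * ennreal B * q i + c i) + ennreal B"
    by (intro add_mono a_0 suminf_le a_Suc) auto
  also have "\<dots> = ennreal \<alpha> * ennreal B * suminf q + suminf c + ennreal B"
    by (subst suminf_add[symmetric]) auto
  finally have sum_a: "suminf a \<le> ennreal \<alpha> * ennreal B * suminf q + suminf c + ennreal B" .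
  have "ennreal (\<epsilon>\<^sup>2) * c i = (\<integral>\<^sup>+\<omega>. indicator (survive \<Omega> i) \<omega> * (ennreal (\<epsilon>\<^sup>2) * ?G (\<omega> i)) \<partial>P)" for i
    unfolding c_def by (subst nn_integral_cmult[symmetric]) (auto simp: mult_ac)
  then have sum_c: "ennreal (\<epsilon>\<^sup>2) * suminf c \<le> ennreal (abp_constant N powr (1 / N) * (diameter \<Omega> + \<Lambda> * \<epsilon>) *
      (\<integral>y. f y ^ N \<partial>lborel) powr (1 / N))"
    using occupation_le[OF \<nu> par \<Omega> law fm f(1,2,3) f(4)[unfolded N_def]]
    by (simp add: N_def flip: ennreal_suminf_cmult)
  have "ennreal_of_enat (exit_time \<Omega> \<omega>) = (\<Sum>i. indicator (survive \<Omega> i) \<omega>)" for \<omega>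
    unfolding ennreal_of_enat_eq_suminf less_exit_time_iff
    by (intro suminf_cong) (simp split: split_indicator)
  then have time: "(\<integral>\<^sup>+\<omega>. ennreal (\<epsilon>\<^sup>2) * ennreal_of_enat (exit_time \<Omega> \<omega>) \<partial>P) = ennreal (\<epsilon>\<^sup>2) * suminf q"
    by (simp add: nn_integral_cmult nn_integral_suminf q_def[abs_def])
  have "(\<integral>\<^sup>+\<omega>. ennreal (\<epsilon>\<^sup>2) * (\<Sum>i. indicator (survive \<Omega> i) \<omega> * ?F (\<omega> i)) \<partial>P) = ennreal (\<epsilon>\<^sup>2) * suminf a"
    by (simp add: nn_integral_cmult nn_integral_suminf a_def[abs_def])
  also have "\<dots> \<le> ennreal (\<epsilon>\<^sup>2) * (ennreal \<alpha> * ennreal B * suminf q + suminf c + ennreal B)"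
    by (intro mult_left_mono sum_a) auto
  also have "\<dots> = (ennreal (\<epsilon>\<^sup>2) + ennreal \<alpha> * (ennreal (\<epsilon>\<^sup>2) * suminf q)) * ennreal B + ennreal (\<epsilon>\<^sup>2) * suminf c"
    by (simp add: distrib_left distrib_right mult_ac add_ac)
  also have "\<dots> \<le> (ennreal (\<epsilon>\<^sup>2) + ennreal \<alpha> * (ennreal (\<epsilon>\<^sup>2) * suminf q)) * ennreal B +
      ennreal (abp_constant N powr (1 / N) * (diameter \<Omega> + \<Lambda> * \<epsilon>) * (\<integral>y. f y ^ N \<partial>lborel) powr (1 / N))"
    by (intro add_left_mono sum_c)
  finally show ?thesis
    by (simp only: time)
qed

section \<open>Zero extension of the reward and the theorem\<close>

lemma integrable_zero_outside_bounded:
  fixes g :: "'a::euclidean_space \<Rightarrow> real"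
  assumes "bounded S" and [measurable]: "g \<in> borel_measurable borel"
    and "\<And>y. y \<notin> S \<Longrightarrow> g y = 0" "\<And>y. \<bar>g y\<bar> \<le> B"
  shows "integrable lborel g"
proof -
  obtain r where "S \<subseteq> ball 0 r"
    using bounded_subset_ballD[OF \<open>bounded S\<close>] by blast
  then have "g y = 0" if "y \<notin> ball 0 r" for y
    using that assms(3) by blast
  then have "g = (\<lambda>y. indicator (ball 0 r) y * g y)"
    by (auto simp: indicator_def fun_eq_iff)
  then show ?thesis
    using integrable_indicator_ball_bounded[of g 0 r B] assms by simp
qed

theorem theorem4p7:
  shows "\<exists>C::real. C > 0 \<and>
    (\<forall>(\<Lambda>::real) (\<alpha>::real) (\<beta>::real) (\<epsilon>::real)
      (\<nu> :: real ^ 'n \<Rightarrow> (real ^ 'n) measure) (\<Omega> :: (real ^ 'n) set) (f :: real ^ 'n \<Rightarrow> real).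
      \<Lambda> \<ge> 1 \<longrightarrow> \<beta> \<in> {0<..1} \<longrightarrow> \<alpha> = 1 - \<beta> \<longrightarrow> \<epsilon> > 0 \<longrightarrow>
      admissible_family \<Lambda> \<nu> \<longrightarrow>
      open \<Omega> \<longrightarrow> connected \<Omega> \<longrightarrow> \<Omega> \<noteq> {} \<longrightarrow> bounded \<Omega> \<longrightarrow>
      (\<forall>y\<in>\<Omega>. f y \<ge> 0) \<longrightarrow> bounded (f ` \<Omega>) \<longrightarrow> f \<in> borel_measurable (restrict_space borel \<Omega>) \<longrightarrow>
      (\<forall>x\<in>\<Omega>. \<forall>P. chain_law \<alpha> \<beta> \<epsilon> \<nu> x P \<longrightarrow>
         (\<integral>\<^sup>+\<omega>. ennreal (\<epsilon>\<^sup>2) *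
             (\<Sum>i. if enat i < exit_time \<Omega> \<omega> then ennreal (f (\<omega> i)) else 0) \<partial>P)
         \<le> (ennreal (\<epsilon>\<^sup>2) + ennreal \<alpha> *
              (\<integral>\<^sup>+\<omega>. ennreal (\<epsilon>\<^sup>2) * ennreal_of_enat (exit_time \<Omega> \<omega>) \<partial>P))
             * ennreal (sup_norm_on \<Omega> f)
           + ennreal (C * (diameter \<Omega> + \<Lambda> * \<epsilon>) * LN_norm_on \<Omega> f)))"
proof (intro exI[of _ "abp_constant CARD('n) powr (1 / CARD('n))"] conjI allI impI ballI)
  show "abp_constant CARD('n) powr (1 / CARD('n)) > 0"
    using abp_constant_pos[of "CARD('n)"] by simp
  fix \<Lambda> \<alpha> \<beta> \<epsilon> :: real and \<nu> :: "real ^ 'n \<Rightarrow> (real ^ 'n) measure" and \<Omega> :: "(real ^ 'n) set"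
    and f :: "real ^ 'n \<Rightarrow> real" and x P
  assume par: "\<Lambda> \<ge> 1" "\<beta> \<in> {0<..1}" "\<alpha> = 1 - \<beta>" "\<epsilon> > 0" and \<nu>: "admissible_family \<Lambda> \<nu>"
    and \<Omega>: "open \<Omega>" "connected \<Omega>" "\<Omega> \<noteq> {}" "bounded \<Omega>"
    and f: "\<forall>y\<in>\<Omega>. f y \<ge> 0" "bounded (f ` \<Omega>)" "f \<in> borel_measurable (restrict_space borel \<Omega>)"
    and x: "x \<in> \<Omega>" and law: "chain_law \<alpha> \<beta> \<epsilon> \<nu> x P"
  \<comment> \<open>The extension \<open>g\<close> of \<open>f\<close> by zero is Borel on the whole
    space. Before the exit time the path lies in \<open>\<Omega>\<close>, where \<open>g\<close> and
    \<open>f\<close> agree.\<close>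
  define N B g where "N = CARD('n)" and "B = sup_norm_on \<Omega> f" and "g y = indicator \<Omega> y * f y" for y
  have "N \<ge> 1"
    by (simp add: N_def Suc_leI)
  have \<Omega>m: "\<Omega> \<in> sets borel"
    using \<Omega> by simp
  have gm[measurable]: "g \<in> borel_measurable borel"
    using f(3) \<Omega>m unfolding g_def
    by (simp add: borel_measurable_restrict_space_iff)
  have "bdd_above ((\<lambda>y. \<bar>f y\<bar>) ` \<Omega>)"
    using f(2) by (auto simp: bounded_iff bdd_above_def)
  then have fB: "\<bar>f y\<bar> \<le> B" if "y \<in> \<Omega>" for y
    unfolding B_def sup_norm_on_def using that by (rule cSUP_upper2) simp_all
  then have "B \<ge> 0"
    using x abs_ge_zero order_trans by blast
  have g: "0 \<le> g y" "g y \<le> B" "y \<notin> \<Omega> \<Longrightarrow> g y = 0" for y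
    using f(1) fB[of y] \<open>B \<ge> 0\<close> by (auto simp: g_def indicator_def)
  have int: "integrable lborel g" "integrable lborel (\<lambda>y. g y ^ N)"
    using g \<open>N \<ge> 1\<close> power_mono[OF g(2,1)]
    by (auto intro!: integrable_zero_outside_bounded[OF \<Omega>(4)] simp: abs_of_nonneg)
  \<comment> \<open>By \<open>N \<ge> 1\<close> the power of 0 is 0, so extending by zero commutes
    with taking the \<open>N\<close>-th power.\<close>
  have "(LINT y:\<Omega>|lborel. f y ^ N) = (\<integral>y. g y ^ N \<partial>lborel)"
    unfolding set_lebesgue_integral_def g_def using \<open>N \<ge> 1\<close>
    by (intro Bochner_Integration.integral_cong) (auto simp: indicator_def)
  then have norm: "LN_norm_on \<Omega> f = (\<integral>y. g y ^ N \<partial>lborel) powr (1 / N)"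
    by (simp add: LN_norm_on_def N_def)
  have "(if enat i < exit_time \<Omega> \<omega> then ennreal (f (\<omega> i)) else 0) = indicator (survive \<Omega> i) \<omega> * ennreal (g (\<omega> i))" for i \<omega>
    by (auto simp: less_exit_time_iff g_def indicator_def survive_def)
  then show "(\<integral>\<^sup>+\<omega>. ennreal (\<epsilon>\<^sup>2) * (\<Sum>i. if enat i < exit_time \<Omega> \<omega> then ennreal (f (\<omega> i)) else 0) \<partial>P)
         \<le> (ennreal (\<epsilon>\<^sup>2) + ennreal \<alpha> * (\<integral>\<^sup>+\<omega>. ennreal (\<epsilon>\<^sup>2) * ennreal_of_enat (exit_time \<Omega> \<omega>) \<partial>P))
             * ennreal (sup_norm_on \<Omega> f)
           + ennreal (abp_constant CARD('n) powr (1 / CARD('n)) * (diameter \<Omega> + \<Lambda> * \<epsilon>) * LN_norm_on \<Omega> f)"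
    using expected_reward_le[OF \<nu> _ _ _ _ _ \<Omega>(4) x \<Omega>m law gm g(1,2) int(1)] int(2) par
    unfolding norm B_def[symmetric] N_def by simp
qed

end
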